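(* Let $X_0$ be the Oikhberg–Ricard space: a separable operator space that is isometrically isomorphic, as a Banach space, to $\ell_2(\mathbb{N})$, and such that every infinite-dimensional closed subspace of $X_0$ fails to have the operator space approximation property (OAP). Then $X_0$ is not completely isomorphic to any subspace of an operator space with a cb-basis, nor to any subspace of an operator space with a cb-frame.
   Context: Operator spaces are norm-complete, and $\|\cdot\|_{cb}$ is the completely bounded norm. The existence of an operator space $X_0$ with the stated properties is a theorem of Oikhberg and Ricard (Operator spaces with few completely bounded maps, Math. Ann. 328 (2004)). An operator space $V$ has the OAP if for every $u\in K(\ell_2)\otimes_{\min}V$ and every $\varepsilon>0$ there is a finite-rank completely bounded map $T:V\to V$ with $\|(\mathrm{id}\otimes T)(u)-u\|<\varepsilon$; here $K(\ell_2)$ is the space of compact operators on $\ell_2$ and $\otimes_{\min}$ is the minimal (spatial) tensor product. A cb-basis of an operator space $Y$ is a Schauder basis $(e_n)$ of $Y$ whose natural projections $P_m(\sum_{n=1}^\infty\alpha_ne_n)=\sum_{n=1}^m\alpha_ne_n$ satisfy $\sup_m\|P_m\|_{cb}<\infty$. A cb-frame for $Y$ is a sequence $(x_n,f_n)_{n\in\mathbb{N}}\subset Y\times Y^*$ with $x=\sum_{n=1}^\infty f_n(x)x_n$ (norm convergent) for all $x\in Y$ and $\sup_m\|S_m\|_{cb}<\infty$, where $S_m(x)=\sum_{n=1}^mf_n(x)x_n$. Two operator spaces are completely isomorphic if there is a completely bounded linear bijection between them with completely bounded inverse. *)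

theory Defs
  imports "HOL-Analysis.Analysis"
begin

subsection \<open>Complex normed spaces and complex Hilbert spaces\<close>

class complex_vector = real_vector +
  fixes scaleC :: "complex \<Rightarrow> 'a \<Rightarrow> 'a" (infixr \<open>*\<^sub>C\<close> 75)
  assumes scaleC_add_right: "a *\<^sub>C (x + y) = a *\<^sub>C x + a *\<^sub>C y"
    and scaleC_add_left: "(a + b) *\<^sub>C x = a *\<^sub>C x + b *\<^sub>C x"
    and scaleC_scaleC: "a *\<^sub>C b *\<^sub>C x = (a * b) *\<^sub>C x"
    and scaleR_scaleC: "r *\<^sub>R x = complex_of_real r *\<^sub>C x"

global_interpretation complex_vector: vector_space "scaleC :: complex \<Rightarrow> 'a \<Rightarrow> 'a::complex_vector"
  defines csubspace = complex_vector.subspace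
    and cspan = complex_vector.span
proof unfold_locales
  fix x :: 'a
  show "1 *\<^sub>C x = x"
    using scaleR_scaleC[of 1 x] by simp
qed (simp_all add: scaleC_add_right scaleC_add_left scaleC_scaleC)

class complex_normed_vector = complex_vector + real_normed_vector +
  assumes norm_scaleC: "norm (a *\<^sub>C x) = cmod a * norm x"

text \<open>The inner product is conjugate linear in its first argument.\<close>

class chilbert_space = complex_normed_vector + banach +
  fixes cinner :: "'a \<Rightarrow> 'a \<Rightarrow> complex"
  assumes cinner_commute: "cinner x y = cnj (cinner y x)"
    and cinner_add_right: "cinner x (y + z) = cinner x y + cinner x z"
    and cinner_scaleC_right: "cinner x (a *\<^sub>C y) = a * cinner x y"
    and cinner_self: "cinner x x = complex_of_real ((norm x)\<^sup>2)"

instantiation complex :: chilbert_space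
begin

definition scaleC_complex :: "complex \<Rightarrow> complex \<Rightarrow> complex"
  where "scaleC_complex a x = a * x"

definition cinner_complex :: "complex \<Rightarrow> complex \<Rightarrow> complex"
  where "cinner_complex x y = cnj x * y"

instance
  by standard
    (simp_all add: scaleC_complex_def cinner_complex_def algebra_simps scaleR_conv_of_real
      norm_mult complex_norm_square del: of_real_power)

end

lemma bounded_linear_scaleC_right: "bounded_linear (\<lambda>x::'a::complex_normed_vector. a *\<^sub>C x)"
proof (rule bounded_linear_intro)
  show "norm (a *\<^sub>C x) \<le> norm x * cmod a" for x :: 'a
    by (simp add: norm_scaleC)
qed (simp_all add: scaleC_add_right scaleR_scaleC scaleC_scaleC mult.commute)

instantiation blinfun :: (real_normed_vector, complex_normed_vector) complex_normed_vector
begin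

lift_definition scaleC_blinfun :: "complex \<Rightarrow> 'a \<Rightarrow>\<^sub>L 'b \<Rightarrow> 'a \<Rightarrow>\<^sub>L 'b" is "\<lambda>a f x. a *\<^sub>C f x"
  by (rule bounded_linear_compose[OF bounded_linear_scaleC_right])

instance
proof
  fix a b :: complex and r :: real and x y :: "'a \<Rightarrow>\<^sub>L 'b"
  show "a *\<^sub>C (x + y) = a *\<^sub>C x + a *\<^sub>C y"
    by transfer (simp add: scaleC_add_right)
  show "(a + b) *\<^sub>C x = a *\<^sub>C x + b *\<^sub>C x"
    by transfer (simp add: scaleC_add_left)
  show "a *\<^sub>C b *\<^sub>C x = (a * b) *\<^sub>C x"
    by transfer (simp add: scaleC_scaleC)
  show "r *\<^sub>R x = complex_of_real r *\<^sub>C x"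
    by transfer (simp add: scaleR_scaleC)
  have "norm (a *\<^sub>C x) = onorm (\<lambda>v. \<bar>cmod a\<bar> *\<^sub>R blinfun_apply x v)"
    by (simp add: norm_blinfun.rep_eq scaleC_blinfun.rep_eq onorm_def norm_scaleC)
  then show "norm (a *\<^sub>C x) = cmod a * norm x"
    by (simp add: onorm_scaleR norm_blinfun.rep_eq blinfun.bounded_linear_right)
qed

end


subsection \<open>The Hilbert space of square-summable sequences\<close>

text \<open>
  The type \<open>'h ell2\<close> is the space of square-summable sequences in \<open>'h\<close>.  Thus
  \<open>complex ell2\<close> is the usual sequence space, and for a Hilbert space \<open>H\<close> the Hilbert space
  tensor product of that space with \<open>H\<close> is \<open>'h ell2\<close>, the elementary tensor of \<open>\<xi>\<close> and \<open>h\<close>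
  being the sequence of all \<open>\<xi>\<^sub>n h\<close>.
\<close>

typedef (overloaded) 'h ell2 = "{x :: nat \<Rightarrow> 'h::real_normed_vector. summable (\<lambda>n. (norm (x n))\<^sup>2)}"
  morphisms ell2_nth Abs_ell2
  by (rule exI[of _ "\<lambda>n. 0"]) simp

setup_lifting type_definition_ell2

lemma summable_ell2_nth: "summable (\<lambda>n. (norm (ell2_nth x n))\<^sup>2)"
  using ell2_nth[of x] by simp

lemma square_summable_add:
  fixes x y :: "nat \<Rightarrow> 'a::real_normed_vector"
  assumes "summable (\<lambda>n. (norm (x n))\<^sup>2)" "summable (\<lambda>n. (norm (y n))\<^sup>2)"
  shows "summable (\<lambda>n. (norm (x n + y n))\<^sup>2)"
proof (rule summable_comparison_test')
  show "summable (\<lambda>n. 2 * (norm (x n))\<^sup>2 + 2 * (norm (y n))\<^sup>2)"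
    by (intro summable_add summable_mult assms)
  fix n :: nat assume "n \<ge> 0"
  have "(norm (x n + y n))\<^sup>2 \<le> (norm (x n) + norm (y n))\<^sup>2"
    by (intro power_mono norm_triangle_ineq norm_ge_zero)
  also have "\<dots> \<le> 2 * (norm (x n))\<^sup>2 + 2 * (norm (y n))\<^sup>2"
    using zero_le_power2[of "norm (x n) - norm (y n)"] by (simp add: power2_sum power2_diff)
  finally show "norm ((norm (x n + y n))\<^sup>2) \<le> 2 * (norm (x n))\<^sup>2 + 2 * (norm (y n))\<^sup>2"
    by simp
qed

lemma square_summable_uminus:
  fixes x :: "nat \<Rightarrow> 'a::real_normed_vector"
  assumes "summable (\<lambda>n. (norm (x n))\<^sup>2)"
  shows "summable (\<lambda>n. (norm (- x n))\<^sup>2)"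
  using assms by simp

lemma square_summable_diff:
  fixes x y :: "nat \<Rightarrow> 'a::real_normed_vector"
  assumes "summable (\<lambda>n. (norm (x n))\<^sup>2)" "summable (\<lambda>n. (norm (y n))\<^sup>2)"
  shows "summable (\<lambda>n. (norm (x n - y n))\<^sup>2)"
  using square_summable_add[OF assms(1) square_summable_uminus[OF assms(2)]] by simp

lemma square_summable_scaleR:
  fixes x :: "nat \<Rightarrow> 'a::real_normed_vector"
  assumes "summable (\<lambda>n. (norm (x n))\<^sup>2)"
  shows "summable (\<lambda>n. (norm (r *\<^sub>R x n))\<^sup>2)"
  using summable_mult[OF assms, of "r\<^sup>2"] by (simp add: power_mult_distrib)

lemma square_summable_scaleC:
  fixes x :: "nat \<Rightarrow> 'a::complex_normed_vector"
  assumes "summable (\<lambda>n. (norm (x n))\<^sup>2)"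
  shows "summable (\<lambda>n. (norm (a *\<^sub>C x n))\<^sup>2)"
  using summable_mult[OF assms, of "(cmod a)\<^sup>2"] by (simp add: power_mult_distrib norm_scaleC)

instantiation ell2 :: (real_normed_vector) real_normed_vector
begin

lift_definition zero_ell2 :: "'a ell2" is "\<lambda>n. 0" by simp
lift_definition plus_ell2 :: "'a ell2 \<Rightarrow> 'a ell2 \<Rightarrow> 'a ell2" is "\<lambda>x y n. x n + y n"
  by (rule square_summable_add)
lift_definition minus_ell2 :: "'a ell2 \<Rightarrow> 'a ell2 \<Rightarrow> 'a ell2" is "\<lambda>x y n. x n - y n"
  by (rule square_summable_diff)
lift_definition uminus_ell2 :: "'a ell2 \<Rightarrow> 'a ell2" is "\<lambda>x n. - x n"
  by (rule square_summable_uminus)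
lift_definition scaleR_ell2 :: "real \<Rightarrow> 'a ell2 \<Rightarrow> 'a ell2" is "\<lambda>r x n. r *\<^sub>R x n"
  by (rule square_summable_scaleR)

definition norm_ell2 :: "'a ell2 \<Rightarrow> real"
  where "norm_ell2 x = sqrt (\<Sum>n. (norm (ell2_nth x n))\<^sup>2)"
definition dist_ell2 :: "'a ell2 \<Rightarrow> 'a ell2 \<Rightarrow> real"
  where "dist_ell2 x y = norm (x - y)"
definition sgn_ell2 :: "'a ell2 \<Rightarrow> 'a ell2"
  where "sgn_ell2 x = inverse (norm x) *\<^sub>R x"
definition uniformity_ell2 :: "('a ell2 \<times> 'a ell2) filter"
  where "uniformity_ell2 = (INF e\<in>{0 <..}. principal {(x, y). dist x y < e})"
definition open_ell2 :: "'a ell2 set \<Rightarrow> bool"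
  where "open_ell2 S = (\<forall>x\<in>S. \<forall>\<^sub>F (x', y) in uniformity. x' = x \<longrightarrow> y \<in> S)"

lemma L2_set_le_norm_ell2: "L2_set (\<lambda>n. norm (ell2_nth x n)) {..<N} \<le> norm x"
  unfolding L2_set_def norm_ell2_def
  by (intro real_sqrt_le_mono sum_le_suminf summable_ell2_nth) auto

lemma norm_ell2_le:
  assumes "\<And>N. L2_set (\<lambda>n. norm (ell2_nth x n)) {..<N} \<le> b"
  shows "norm x \<le> b"
proof -
  have b: "0 \<le> b" using assms[of 0] by simp
  have "(\<Sum>n. (norm (ell2_nth x n))\<^sup>2) \<le> b\<^sup>2"
  proof (rule suminf_le_const[OF summable_ell2_nth])
    fix N
    have "sqrt (\<Sum>n<N. (norm (ell2_nth x n))\<^sup>2) \<le> b"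
      using assms[of N] by (simp add: L2_set_def)
    then show "(\<Sum>n<N. (norm (ell2_nth x n))\<^sup>2) \<le> b\<^sup>2"
      by (rule sqrt_le_D)
  qed
  then show ?thesis
    unfolding norm_ell2_def using b by (rule real_le_lsqrt[rotated]) 
qed

instance
proof
  fix x y z :: "'a ell2" and a b :: real
  show "x + y + z = x + (y + z)" by transfer (simp add: add.assoc)
  show "x + y = y + x" by transfer (simp add: add.commute)
  show "0 + x = x" by transfer simp
  show "- x + x = 0" by transfer simp
  show "x - y = x + - y" by transfer simp
  show "a *\<^sub>R (x + y) = a *\<^sub>R x + a *\<^sub>R y" by transfer (simp add: scaleR_add_right)
  show "(a + b) *\<^sub>R x = a *\<^sub>R x + b *\<^sub>R x" by transfer (simp add: scaleR_add_left)
  show "a *\<^sub>R b *\<^sub>R x = (a * b) *\<^sub>R x" by transfer simp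
  show "1 *\<^sub>R x = x" by transfer simp
  show "sgn x = inverse (norm x) *\<^sub>R x" by (rule sgn_ell2_def)
  show "dist x y = norm (x - y)" by (rule dist_ell2_def)
  show "uniformity = (INF e\<in>{0 <..}. principal {(x :: 'a ell2, y). dist x y < e})"
    by (rule uniformity_ell2_def)
  show "open U = (\<forall>x\<in>U. \<forall>\<^sub>F (x', y) in uniformity. x' = x \<longrightarrow> y \<in> U)" for U :: "'a ell2 set"
    by (rule open_ell2_def)
  show "(norm x = 0) = (x = 0)"
  proof
    assume "norm x = 0"
    then have "ell2_nth x = (\<lambda>n. 0)"
      by (simp add: norm_ell2_def suminf_eq_zero_iff[OF summable_ell2_nth] fun_eq_iff)
    then show "x = 0" by (simp add: ell2_nth_inject[symmetric] zero_ell2.rep_eq)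
  qed (simp add: norm_ell2_def zero_ell2.rep_eq)
  show "norm (x + y) \<le> norm x + norm y"
  proof (rule norm_ell2_le)
    fix N
    have "L2_set (\<lambda>n. norm (ell2_nth (x + y) n)) {..<N}
        \<le> L2_set (\<lambda>n. norm (ell2_nth x n) + norm (ell2_nth y n)) {..<N}"
      by (intro L2_set_mono) (auto simp: plus_ell2.rep_eq norm_triangle_ineq)
    also have "\<dots> \<le> L2_set (\<lambda>n. norm (ell2_nth x n)) {..<N} + L2_set (\<lambda>n. norm (ell2_nth y n)) {..<N}"
      by (rule L2_set_triangle_ineq)
    also have "\<dots> \<le> norm x + norm y"
      by (intro add_mono L2_set_le_norm_ell2)
    finally show "L2_set (\<lambda>n. norm (ell2_nth (x + y) n)) {..<N} \<le> norm x + norm y" .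
  qed
  show "norm (a *\<^sub>R x) = \<bar>a\<bar> * norm x"
    by (simp add: norm_ell2_def scaleR_ell2.rep_eq power_mult_distrib
        suminf_mult[OF summable_ell2_nth] real_sqrt_mult)
qed

end

lemma norm_ell2_nth_le: "norm (ell2_nth x n) \<le> norm x"
proof -
  have "norm (ell2_nth x n) \<le> L2_set (\<lambda>n. norm (ell2_nth x n)) {..<Suc n}"
    by (rule member_le_L2_set) auto
  then show ?thesis
    using L2_set_le_norm_ell2[of x "Suc n"] by linarith
qed

instance ell2 :: (banach) banach
proof
  fix X :: "nat \<Rightarrow> 'a ell2"
  assume X: "Cauchy X"
  have "Cauchy (\<lambda>k. ell2_nth (X k) n)" for n
  proof (rule CauchyI)
    fix e :: real assume "0 < e"
    from CauchyD[OF X this] obtain M where M: "\<forall>m\<ge>M. \<forall>k\<ge>M. norm (X m - X k) < e" by blast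
    have "norm (ell2_nth (X m) n - ell2_nth (X k) n) < e" if "m \<ge> M" "k \<ge> M" for m k
    proof -
      have "norm (X m - X k) < e" using M that by blast
      with norm_ell2_nth_le[of "X m - X k" n] show ?thesis by (simp add: minus_ell2.rep_eq)
    qed
    then show "\<exists>M. \<forall>m\<ge>M. \<forall>k\<ge>M. norm (ell2_nth (X m) n - ell2_nth (X k) n) < e" by blast
  qed
  then have "convergent (\<lambda>k. ell2_nth (X k) n)" for n
    by (rule Cauchy_convergent)
  then have "\<forall>n. \<exists>l. (\<lambda>k. ell2_nth (X k) n) \<longlonglongrightarrow> l"
    unfolding convergent_def by blast
  from choice[OF this] obtain l where l: "\<And>n. (\<lambda>k. ell2_nth (X k) n) \<longlonglongrightarrow> l n" by blast
  have bound: "L2_set (\<lambda>n. norm (ell2_nth (X m) n - l n)) {..<N} \<le> e"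
    if M: "\<forall>m\<ge>M. \<forall>k\<ge>M. norm (X m - X k) < e" and "m \<ge> M" for m M N e
  proof (rule tendsto_upperbound)
    show "(\<lambda>k. L2_set (\<lambda>n. norm (ell2_nth (X m) n - ell2_nth (X k) n)) {..<N})
        \<longlonglongrightarrow> L2_set (\<lambda>n. norm (ell2_nth (X m) n - l n)) {..<N}"
      unfolding L2_set_def by (intro tendsto_intros l)
    show "\<forall>\<^sub>F k in sequentially. L2_set (\<lambda>n. norm (ell2_nth (X m) n - ell2_nth (X k) n)) {..<N} \<le> e"
      unfolding eventually_sequentially
    proof (intro exI allI impI)
      fix k assume "M \<le> k"
      then have "norm (X m - X k) < e" using M \<open>m \<ge> M\<close> by blast
      with L2_set_le_norm_ell2[of "X m - X k" N]
      show "L2_set (\<lambda>n. norm (ell2_nth (X m) n - ell2_nth (X k) n)) {..<N} \<le> e"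
        by (simp add: minus_ell2.rep_eq)
    qed
  qed simp
  have "summable (\<lambda>n. (norm (l n))\<^sup>2)"
  proof -
    from CauchyD[OF X zero_less_one] obtain M
      where M: "\<forall>m\<ge>M. \<forall>k\<ge>M. norm (X m - X k) < 1" by blast
    have "summable (\<lambda>n. (norm (ell2_nth (X M) n - l n))\<^sup>2)"
    proof (rule summableI_nonneg_bounded)
      fix N
      have "sqrt (\<Sum>n<N. (norm (ell2_nth (X M) n - l n))\<^sup>2) \<le> 1"
        using bound[OF M order_refl, of N] by (simp add: L2_set_def)
      then show "(\<Sum>n<N. (norm (ell2_nth (X M) n - l n))\<^sup>2) \<le> 1" by simp
    qed simp
    from square_summable_diff[OF summable_ell2_nth[of "X M"] this] show ?thesis by simp
  qed
  then have nth_l: "ell2_nth (Abs_ell2 l) = l" by (simp add: Abs_ell2_inverse)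
  have "X \<longlonglongrightarrow> Abs_ell2 l"
  proof (rule LIMSEQ_I)
    fix e :: real assume "0 < e"
    then have "0 < e / 2" by simp
    from CauchyD[OF X this] obtain M where M: "\<forall>m\<ge>M. \<forall>k\<ge>M. norm (X m - X k) < e / 2" by blast
    have "norm (X m - Abs_ell2 l) < e" if "m \<ge> M" for m
    proof -
      have "norm (X m - Abs_ell2 l) \<le> e / 2"
        by (rule norm_ell2_le) (use bound[OF M that] in \<open>simp add: minus_ell2.rep_eq nth_l\<close>)
      then show ?thesis using \<open>0 < e\<close> by linarith
    qed
    then show "\<exists>no. \<forall>n\<ge>no. norm (X n - Abs_ell2 l) < e" by blast
  qed
  then show "convergent X" by (rule convergentI)
qed

instantiation ell2 :: (complex_normed_vector) complex_normed_vector
begin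

lift_definition scaleC_ell2 :: "complex \<Rightarrow> 'a ell2 \<Rightarrow> 'a ell2" is "\<lambda>a x n. a *\<^sub>C x n"
  by (rule square_summable_scaleC)

instance
proof
  fix x y :: "'a ell2" and a b :: complex and r :: real
  show "a *\<^sub>C (x + y) = a *\<^sub>C x + a *\<^sub>C y" by transfer (simp add: scaleC_add_right)
  show "(a + b) *\<^sub>C x = a *\<^sub>C x + b *\<^sub>C x" by transfer (simp add: scaleC_add_left)
  show "a *\<^sub>C b *\<^sub>C x = (a * b) *\<^sub>C x" by transfer (simp add: scaleC_scaleC)
  show "r *\<^sub>R x = complex_of_real r *\<^sub>C x" by transfer (simp add: scaleR_scaleC)
  show "norm (a *\<^sub>C x) = cmod a * norm x"
    by (simp add: norm_ell2_def scaleC_ell2.rep_eq norm_scaleC power_mult_distrib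
        suminf_mult[OF summable_ell2_nth] real_sqrt_mult)
qed

end

lemma cinner_add_left: "cinner (x + y) z = cinner x z + cinner (y::'a::chilbert_space) z"
  by (metis cinner_commute cinner_add_right complex_cnj_add)

lemma cinner_scaleC_left: "cinner (a *\<^sub>C x) (y::'a::chilbert_space) = cnj a * cinner x y"
  by (metis cinner_commute cinner_scaleC_right complex_cnj_mult)

lemma cinner_polarization:
  fixes x y :: "'a::chilbert_space"
  shows "cinner x y = (complex_of_real ((norm (x + y))\<^sup>2) - complex_of_real ((norm (x + (-1) *\<^sub>C y))\<^sup>2)
    - \<i> * complex_of_real ((norm (x + \<i> *\<^sub>C y))\<^sup>2) + \<i> * complex_of_real ((norm (x + (-\<i>) *\<^sub>C y))\<^sup>2)) / 4"
  unfolding cinner_self[symmetric] cinner_add_left cinner_add_right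
    cinner_scaleC_left cinner_scaleC_right
  by (simp add: algebra_simps)

lemma summable_cinner_ell2:
  fixes x y :: "'a::chilbert_space ell2"
  shows "summable (\<lambda>n. cinner (ell2_nth x n) (ell2_nth y n))"
  unfolding cinner_polarization
  by (intro summable_divide summable_add summable_diff summable_mult summable_of_real
      square_summable_add square_summable_scaleC summable_ell2_nth)

instantiation ell2 :: (chilbert_space) chilbert_space
begin

definition cinner_ell2 :: "'a ell2 \<Rightarrow> 'a ell2 \<Rightarrow> complex"
  where "cinner_ell2 x y = (\<Sum>n. cinner (ell2_nth x n) (ell2_nth y n))"

instance
proof
  fix x y z :: "'a ell2" and a :: complex
  show "cinner x y = cnj (cinner y x)"
  proof -
    have "(\<lambda>n. cnj (cinner (ell2_nth y n) (ell2_nth x n))) sums cnj (cinner y x)"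
      unfolding cinner_ell2_def sums_cnj by (rule summable_sums[OF summable_cinner_ell2])
    then show ?thesis
      by (simp add: cinner_ell2_def sums_iff cinner_commute[symmetric])
  qed
  show "cinner x (y + z) = cinner x y + cinner x z"
    by (simp add: cinner_ell2_def plus_ell2.rep_eq cinner_add_right
        suminf_add[OF summable_cinner_ell2 summable_cinner_ell2])
  show "cinner x (a *\<^sub>C y) = a * cinner x y"
    by (simp add: cinner_ell2_def scaleC_ell2.rep_eq cinner_scaleC_right
        suminf_mult[OF summable_cinner_ell2])
  show "cinner x x = complex_of_real ((norm x)\<^sup>2)"
    by (simp add: cinner_ell2_def cinner_self norm_ell2_def suminf_of_real summable_ell2_nth
        suminf_nonneg del: of_real_power)
qed

end

lift_definition tensor_vec :: "complex ell2 \<Rightarrow> 'h \<Rightarrow> 'h::chilbert_space ell2"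
  is "\<lambda>\<xi> h n. \<xi> n *\<^sub>C h"
proof -
  fix \<xi> :: "nat \<Rightarrow> complex" and h :: 'h
  assume "summable (\<lambda>n. (norm (\<xi> n))\<^sup>2)"
  from summable_mult2[OF this, of "(norm h)\<^sup>2"] show "summable (\<lambda>n. (norm (\<xi> n *\<^sub>C h))\<^sup>2)"
    by (simp add: norm_scaleC power_mult_distrib)
qed


subsection \<open>Operator spaces and completely bounded maps\<close>

definition cfinite_dim :: "'a::complex_vector set \<Rightarrow> bool"
  where "cfinite_dim V \<longleftrightarrow> (\<exists>B. finite B \<and> V \<subseteq> cspan B)"

definition clinear_on :: "'a::complex_vector set \<Rightarrow> ('a \<Rightarrow> 'b::complex_vector) \<Rightarrow> bool"
  where "clinear_on V T \<longleftrightarrow>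
    (\<forall>x\<in>V. \<forall>y\<in>V. T (x + y) = T x + T y) \<and> (\<forall>a. \<forall>x\<in>V. T (a *\<^sub>C x) = a *\<^sub>C T x)"

definition bounded_clinear_on ::
  "'a::complex_normed_vector set \<Rightarrow> ('a \<Rightarrow> 'b::complex_normed_vector) \<Rightarrow> bool"
  where "bounded_clinear_on V T \<longleftrightarrow> clinear_on V T \<and> (\<exists>C. \<forall>x\<in>V. norm (T x) \<le> C * norm x)"

text \<open>
  Elements of \<open>'h \<Rightarrow>\<^sub>L 'h\<close> are only real linear.  The complex linear ones form \<open>B(H)\<close>, on which
  the norm of \<open>'h \<Rightarrow>\<^sub>L 'h\<close> is the usual operator norm.
\<close>

definition bounded_ops :: "('h::chilbert_space \<Rightarrow>\<^sub>L 'h) set"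
  where "bounded_ops = {S. clinear_on UNIV (blinfun_apply S)}"

definition operator_space :: "('h::chilbert_space \<Rightarrow>\<^sub>L 'h) set \<Rightarrow> bool"
  where "operator_space V \<longleftrightarrow> V \<subseteq> bounded_ops \<and> csubspace V \<and> closed V"

text \<open>
  The norm of the matrix \<open>(A i j)\<^bsub>i,j<n\<^esub>\<close> as an operator on the Hilbert space direct sum of
  \<open>n\<close> copies of \<open>H\<close>.
\<close>

definition matrix_norm :: "nat \<Rightarrow> (nat \<Rightarrow> nat \<Rightarrow> 'h::chilbert_space \<Rightarrow>\<^sub>L 'h) \<Rightarrow> real"
  where "matrix_norm n A =
    Sup {L2_set (\<lambda>i. norm (\<Sum>j<n. blinfun_apply (A i j) (\<xi> j))) {..<n} |\<xi>.
      L2_set (\<lambda>j. norm (\<xi> j)) {..<n} \<le> 1}"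

definition cb_norm ::
  "('h::chilbert_space \<Rightarrow>\<^sub>L 'h) set \<Rightarrow> (('h \<Rightarrow>\<^sub>L 'h) \<Rightarrow> ('k::chilbert_space \<Rightarrow>\<^sub>L 'k)) \<Rightarrow> ennreal"
  where "cb_norm V T =
    (SUP n. SUP A\<in>{A. (\<forall>i<n. \<forall>j<n. A i j \<in> V) \<and> matrix_norm n A \<le> 1}.
      ennreal (matrix_norm n (\<lambda>i j. T (A i j))))"

definition completely_bounded ::
  "('h::chilbert_space \<Rightarrow>\<^sub>L 'h) set \<Rightarrow> (('h \<Rightarrow>\<^sub>L 'h) \<Rightarrow> ('k::chilbert_space \<Rightarrow>\<^sub>L 'k)) \<Rightarrow> bool"
  where "completely_bounded V T \<longleftrightarrow> clinear_on V T \<and> cb_norm V T < \<infinity>"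

definition completely_isomorphic ::
  "('h::chilbert_space \<Rightarrow>\<^sub>L 'h) set \<Rightarrow> ('k::chilbert_space \<Rightarrow>\<^sub>L 'k) set \<Rightarrow> bool"
  where "completely_isomorphic V W \<longleftrightarrow>
    (\<exists>T. bij_betw T V W \<and> completely_bounded V T \<and> completely_bounded W (inv_into V T))"

definition isometric_to_ell2 :: "'a::complex_normed_vector set \<Rightarrow> bool"
  where "isometric_to_ell2 V \<longleftrightarrow>
    (\<exists>J :: 'a \<Rightarrow> complex ell2. clinear_on V J \<and> bij_betw J V UNIV \<and> (\<forall>x\<in>V. norm (J x) = norm x))"


subsection \<open>The operator space approximation property\<close>

definition compact_ops :: "('h::chilbert_space \<Rightarrow>\<^sub>L 'h) set"
  where "compact_ops = {k \<in> bounded_ops. compact (closure (blinfun_apply k ` cball 0 1))}"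

definition op_tensor ::
  "(complex ell2 \<Rightarrow>\<^sub>L complex ell2) \<Rightarrow> ('h::chilbert_space \<Rightarrow>\<^sub>L 'h) \<Rightarrow> ('h ell2 \<Rightarrow>\<^sub>L 'h ell2)"
  where "op_tensor k v = (THE S. S \<in> bounded_ops \<and>
    (\<forall>\<xi> h. blinfun_apply S (tensor_vec \<xi> h) = tensor_vec (blinfun_apply k \<xi>) (blinfun_apply v h)))"

definition compact_tensor_min ::
  "('h::chilbert_space \<Rightarrow>\<^sub>L 'h) set \<Rightarrow> ('h ell2 \<Rightarrow>\<^sub>L 'h ell2) set"
  where "compact_tensor_min V = closure (cspan {op_tensor k v |k v. k \<in> compact_ops \<and> v \<in> V})"

text \<open>
  For completely bounded \<open>T\<close> from \<open>V\<close> to \<open>V\<close> the conditions determine \<open>\<Phi>\<close> uniquely on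
  \<open>compact_tensor_min V\<close>; the values of \<open>\<Phi>\<close> elsewhere are irrelevant.
\<close>

definition id_tensor ::
  "('h::chilbert_space \<Rightarrow>\<^sub>L 'h) set \<Rightarrow> (('h \<Rightarrow>\<^sub>L 'h) \<Rightarrow> ('h \<Rightarrow>\<^sub>L 'h)) \<Rightarrow>
    ('h ell2 \<Rightarrow>\<^sub>L 'h ell2) \<Rightarrow> ('h ell2 \<Rightarrow>\<^sub>L 'h ell2)"
  where "id_tensor V T = (SOME \<Phi>. bounded_clinear_on (compact_tensor_min V) \<Phi> \<and>
    (\<forall>k\<in>compact_ops. \<forall>v\<in>V. \<Phi> (op_tensor k v) = op_tensor k (T v)))"

definition OAP :: "('h::chilbert_space \<Rightarrow>\<^sub>L 'h) set \<Rightarrow> bool"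
  where "OAP V \<longleftrightarrow> (\<forall>u\<in>compact_tensor_min V. \<forall>\<epsilon>>0.
    \<exists>T. T ` V \<subseteq> V \<and> completely_bounded V T \<and> cfinite_dim (T ` V) \<and>
      norm (id_tensor V T u - u) < \<epsilon>)"


subsection \<open>cb-bases and cb-frames\<close>

definition schauder_basis :: "'a::complex_normed_vector set \<Rightarrow> (nat \<Rightarrow> 'a) \<Rightarrow> bool"
  where "schauder_basis Y e \<longleftrightarrow>
    range e \<subseteq> Y \<and> (\<forall>x\<in>Y. \<exists>!\<alpha>. (\<lambda>n. \<alpha> n *\<^sub>C e n) sums x)"

definition basis_proj :: "(nat \<Rightarrow> 'a::complex_normed_vector) \<Rightarrow> nat \<Rightarrow> 'a \<Rightarrow> 'a"
  where "basis_proj e m x = (\<Sum>n<m. (THE \<alpha>. (\<lambda>n. \<alpha> n *\<^sub>C e n) sums x) n *\<^sub>C e n)"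

definition cb_basis :: "('h::chilbert_space \<Rightarrow>\<^sub>L 'h) set \<Rightarrow> (nat \<Rightarrow> 'h \<Rightarrow>\<^sub>L 'h) \<Rightarrow> bool"
  where "cb_basis Y e \<longleftrightarrow> schauder_basis Y e \<and> (SUP m. cb_norm Y (basis_proj e m)) < \<infinity>"

definition cb_frame ::
  "('h::chilbert_space \<Rightarrow>\<^sub>L 'h) set \<Rightarrow> (nat \<Rightarrow> 'h \<Rightarrow>\<^sub>L 'h) \<Rightarrow> (nat \<Rightarrow> ('h \<Rightarrow>\<^sub>L 'h) \<Rightarrow> complex) \<Rightarrow> bool"
  where "cb_frame Y x f \<longleftrightarrow>
    range x \<subseteq> Y \<and> (\<forall>n. bounded_clinear_on Y (f n)) \<and>
    (\<forall>y\<in>Y. (\<lambda>n. f n y *\<^sub>C x n) sums y) \<and>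
    (SUP m. cb_norm Y (\<lambda>y. \<Sum>n<m. f n y *\<^sub>C x n)) < \<infinity>"

end

theory Submission
  imports Defs
begin

text \<open>
  Let \<open>T\<close> be a complete isomorphism of \<open>X\<^sub>0\<close> onto a subspace of \<open>Y\<close>, and let \<open>S\<^sub>m\<close> be the partial sum
  operators of the cb-basis or cb-frame: they have finite rank, are uniformly completely bounded and
  converge pointwise to the identity.  As \<open>X\<^sub>0\<close> is infinite dimensional and Hilbertian, one can choose
  alternately indices \<open>m\<^sub>k\<close> and orthonormal vectors \<open>x\<^sub>k\<close> in \<open>X\<^sub>0\<close> such that \<open>S\<^bsub>m\<^sub>k\<^esub> T x\<^sub>j\<close> is within \<open>1 / (k + 1)\<close>
  of \<open>T x\<^sub>j\<close> for \<open>j < k\<close> and vanishes for \<open>j \<ge> k\<close>.  On the closed span \<open>V\<close> of the \<open>x\<^sub>j\<close> the orthogonal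
  projection \<open>q\<^sub>k\<close> onto the first \<open>k\<close> of them satisfies
  \<open>T q\<^sub>k = S\<^bsub>m\<^sub>k\<^esub> T + \<Sum>\<^bsub>j<k\<^esub> \<langle>x\<^sub>j, \<cdot>\<rangle> d\<^sub>k\<^sub>j\<close> with \<open>\<parallel>d\<^sub>k\<^sub>j\<parallel> \<le> 1 / (k + 1)\<close>.  Bounded functionals are completely bounded
  with the same norm, so the \<open>q\<^sub>k\<close> are uniformly completely bounded, hence \<open>V\<close> has the OAP.
\<close>


subsection \<open>Orthonormal families\<close>

text \<open>The isometry of \<open>X\<^sub>0\<close> with \<open>complex ell2\<close> controls
  single norms only: orthogonal projections on \<open>X\<^sub>0\<close> are contractions, but
  nothing bounds their matrix norms. The operators \<open>S\<^sub>m T\<close> are uniformly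
  completely bounded, but their values may leave the image of \<open>X\<^sub>0\<close>, so the
  inverse of \<open>T\<close> cannot be applied to them. The identity for \<open>T q\<^sub>k\<close>
  joins the two: its right side is estimated in \<open>Y\<close>, while its left side lies in the
  image of \<open>X\<^sub>0\<close> and can be pulled back. The hump is exact on one side, since a
  partial sum operator vanishes on the common kernel of finitely many coefficient functionals, and
  in infinite dimension this kernel still contains a unit vector orthogonal to finitely many given
  ones. On the other side the errors only have to be bounded in total: \<open>k\<close> of them,
  each at most \<open>1 / (k + 1)\<close>, add up to less than 1. The convergence of
  \<open>q\<^sub>k\<close> to the identity on \<open>V\<close> comes from the Hilbert norm, not from
  small errors. A uniform cb bound becomes a uniform norm bound for the amplifications to the tensor
  product, where density then leaves only elementary tensors to check.\<close>

lemma clinear_on_sum: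
  assumes V: "csubspace V" and T: "clinear_on V T" and "\<And>i. i \<in> I \<Longrightarrow> x i \<in> V"
  shows "T (\<Sum>i\<in>I. x i) = (\<Sum>i\<in>I. T (x i))"
proof -
  have 0: "T 0 = 0"
    using T complex_vector.subspace_0[OF V] unfolding clinear_on_def
    by (metis complex_vector.scale_zero_left)
  show ?thesis
    using assms(3)
  proof (induction I rule: infinite_finite_induct)
    case (insert i I)
    have "T (x i + (\<Sum>i\<in>I. x i)) = T (x i) + T (\<Sum>i\<in>I. x i)"
      using T insert.prems complex_vector.subspace_sum[OF V, of I x] unfolding clinear_on_def by simp
    with insert show ?case by simp
  qed (simp_all add: 0)
qed

lemma clinear_on_scaleC: "clinear_on V T \<Longrightarrow> x \<in> V \<Longrightarrow> T (a *\<^sub>C x) = a *\<^sub>C T x"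
  unfolding clinear_on_def by simp

lemma clinear_on_add: "clinear_on V T \<Longrightarrow> x \<in> V \<Longrightarrow> y \<in> V \<Longrightarrow> T (x + y) = T x + T y"
  unfolding clinear_on_def by simp

lemma clinear_on_0: "csubspace V \<Longrightarrow> clinear_on V T \<Longrightarrow> T 0 = 0"
  using clinear_on_sum[of V T "{}"] by simp

lemma clinear_on_diff:
  assumes "csubspace V" "clinear_on V T" "x \<in> V" "y \<in> V"
  shows "T (x - y) = T x - T y"
  using clinear_on_add[OF assms(2), of "x - y" y] complex_vector.subspace_diff[OF assms(1)] assms
  by simp

lemma clinear_on_subset: "clinear_on V T \<Longrightarrow> W \<subseteq> V \<Longrightarrow> clinear_on W T"
  unfolding clinear_on_def by blast

lemma cinner_sum_right: "cinner (x::'a::chilbert_space) (\<Sum>i\<in>I. f i) = (\<Sum>i\<in>I. cinner x (f i))"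
proof -
  have "clinear_on UNIV (cinner x)"
    by (simp add: clinear_on_def cinner_add_right cinner_scaleC_right scaleC_complex_def)
  from clinear_on_sum[OF complex_vector.subspace_UNIV this] show ?thesis by simp
qed

lemma cinner_sum_left: "cinner (\<Sum>i\<in>I. f i) (x::'a::chilbert_space) = (\<Sum>i\<in>I. cinner (f i) x)"
  by (subst cinner_commute) (simp add: cinner_sum_right cinner_commute[symmetric])

lemma cinner_diff_right: "cinner (x::'a::chilbert_space) (y - z) = cinner x y - cinner x z"
  using cinner_add_right[of x "y - z" z] by simp

lemma norm_square_add_orthogonal:
  fixes x y :: "'a::chilbert_space"
  assumes "cinner x y = 0"
  shows "(norm (x + y))\<^sup>2 = (norm x)\<^sup>2 + (norm y)\<^sup>2"
proof -
  have "cinner y x = 0" using assms cinner_commute[of y x] by simp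
  then have "cinner (x + y) (x + y) = cinner x x + cinner y y"
    by (simp add: cinner_add_left cinner_add_right assms)
  then show ?thesis
    unfolding cinner_self using of_real_eq_iff by (metis of_real_add)
qed

text \<open>The index set is explicit so that one notion serves both sequences, indexed by
  \<open>UNIV\<close>, and finite sets of vectors, indexed by themselves through
  \<open>\<lambda>b. b\<close>.\<close>

definition orthonormal_on :: "'i set \<Rightarrow> ('i \<Rightarrow> 'a::chilbert_space) \<Rightarrow> bool"
  where "orthonormal_on I e \<longleftrightarrow> (\<forall>i\<in>I. \<forall>j\<in>I. cinner (e i) (e j) = of_bool (i = j))"

lemma cinner_orthonormal_sum:
  assumes "orthonormal_on I e" "finite I" "i \<in> I"
  shows "cinner (e i) (\<Sum>j\<in>I. c j *\<^sub>C e j) = c i"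
proof -
  have "cinner (e i) (\<Sum>j\<in>I. c j *\<^sub>C e j) = (\<Sum>j\<in>I. if i = j then c j else 0)"
    unfolding cinner_sum_right cinner_scaleC_right
    using assms by (intro sum.cong) (auto simp: orthonormal_on_def)
  then show ?thesis using assms by simp
qed

lemma norm_orthonormal_sum:
  assumes "orthonormal_on I e" "finite I"
  shows "(norm (\<Sum>i\<in>I. c i *\<^sub>C e i))\<^sup>2 = (\<Sum>i\<in>I. (cmod (c i))\<^sup>2)"
proof -
  have "cinner (\<Sum>i\<in>I. c i *\<^sub>C e i) (\<Sum>i\<in>I. c i *\<^sub>C e i) = (\<Sum>i\<in>I. cnj (c i) * c i)"
    by (simp add: cinner_sum_left cinner_scaleC_left cinner_orthonormal_sum[OF assms] cong: sum.cong)
  also have "\<dots> = complex_of_real (\<Sum>i\<in>I. (cmod (c i))\<^sup>2)"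
    by (simp add: complex_norm_square mult.commute del: of_real_power)
  finally show ?thesis
    unfolding cinner_self using of_real_eq_iff by blast
qed

text \<open>Bessel's inequality: the remainder \<open>x - p\<close> is orthogonal to the projection
  \<open>p\<close>, and Pythagoras applies.\<close>

lemma norm_orthonormal_projection_le:
  assumes "orthonormal_on I e" "finite I"
  shows "norm (\<Sum>i\<in>I. cinner (e i) x *\<^sub>C e i) \<le> norm x"
proof -
  define p where "p = (\<Sum>i\<in>I. cinner (e i) x *\<^sub>C e i)"
  have "cinner p (x - p) = 0"
    unfolding p_def cinner_sum_left cinner_scaleC_left cinner_diff_right
    by (simp add: cinner_orthonormal_sum[OF assms])
  from norm_square_add_orthogonal[OF this] have "(norm p)\<^sup>2 \<le> (norm x)\<^sup>2" by simp
  then show ?thesis unfolding p_def by (rule power2_le_imp_le) simp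
qed

text \<open>The case of one vector in Bessel's inequality. It gives the coordinate functionals of
  the correction terms the bound 1.\<close>

lemma cmod_cinner_le_unit:
  assumes "cinner e e = 1"
  shows "cmod (cinner e x) \<le> norm x"
proof -
  have "norm e = 1"
    using assms unfolding cinner_self by (metis norm_ge_zero of_real_eq_1_iff power2_eq_1_iff power2_eq_iff_nonneg zero_le_one one_power2)
  with norm_orthonormal_projection_le[of "{()}" "\<lambda>_. e" x] assms show ?thesis
    by (simp add: orthonormal_on_def norm_scaleC)
qed

lemma orthonormal_inj:
  assumes "orthonormal_on UNIV e"
  shows "inj e"
proof (rule injI, rule ccontr)
  fix i j assume "e i = e j" "i \<noteq> j"
  then show False using assms unfolding orthonormal_on_def
    by (metis UNIV_I of_bool_eq zero_neq_one)
qed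

text \<open>Pairing a vanishing linear combination with one of its vectors isolates the coefficient
  of that vector.\<close>

lemma orthonormal_independent:
  assumes "orthonormal_on UNIV e"
  shows "\<not> complex_vector.dependent (range e)"
proof -
  have "inj e" using assms by (rule orthonormal_inj)
  have 0: "u v = 0" if t: "finite t" "t \<subseteq> range e" "(\<Sum>v\<in>t. u v *\<^sub>C v) = 0" "v \<in> t" for t u v
  proof -
    have "orthonormal_on t (\<lambda>v. v)"
      unfolding orthonormal_on_def
    proof (intro ballI)
      fix x y assume "x \<in> t" "y \<in> t"
      then obtain i j where "x = e i" "y = e j" using t(2) by blast
      then show "cinner x y = of_bool (x = y)"
        using assms \<open>inj e\<close> by (simp add: orthonormal_on_def inj_eq)
    qed
    from cinner_orthonormal_sum[OF this t(1,4), of u] t(3) cinner_diff_right[of v 0 0] show ?thesis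
      by simp
  qed
  then show ?thesis
    unfolding complex_vector.dependent_explicit by blast
qed

text \<open>Gram-Schmidt: the component \<open>y\<close> of a new vector orthogonal to the old basis
  is normalised and added, unless it is zero.\<close>

lemma finite_orthonormal_expansion:
  fixes X :: "'a::chilbert_space set"
  assumes "finite X"
  obtains B where "finite B" "orthonormal_on B (\<lambda>b. b)" "\<And>x. x \<in> X \<Longrightarrow> x = (\<Sum>b\<in>B. cinner b x *\<^sub>C b)"
proof -
  have "\<exists>B. finite B \<and> orthonormal_on B (\<lambda>b. b) \<and> (\<forall>x\<in>X. x = (\<Sum>b\<in>B. cinner b x *\<^sub>C b))"
    using assms
  proof (induction X)
    case empty
    show ?case by (rule exI[of _ "{}"]) (simp add: orthonormal_on_def)
  next
    case (insert x X)
    then obtain B where B: "finite B" "orthonormal_on B (\<lambda>b. b)"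
      "\<And>x. x \<in> X \<Longrightarrow> x = (\<Sum>b\<in>B. cinner b x *\<^sub>C b)" by blast
    define y where "y = x - (\<Sum>b\<in>B. cinner b x *\<^sub>C b)"
    show ?case
    proof (cases "y = 0")
      case True
      with B show ?thesis by (intro exI[of _ B]) (auto simp: y_def)
    next
      case False
      define e where "e = complex_of_real (inverse (norm y)) *\<^sub>C y"
      have by0: "cinner b y = 0" if "b \<in> B" for b
        by (simp add: y_def cinner_diff_right cinner_orthonormal_sum[OF B(2,1) that])
      then have be: "cinner b e = 0" if "b \<in> B" for b
        using that by (simp add: e_def cinner_scaleC_right)
      then have eb: "cinner e b = 0" if "b \<in> B" for b
        using that cinner_commute[of e b] by simp
      have ee: "cinner e e = 1"
        using False by (simp add: e_def cinner_self norm_scaleC norm_inverse)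
      have eB: "e \<notin> B" using eb ee by force
      have orth: "orthonormal_on (insert e B) (\<lambda>b. b)"
        using B(2) be eb ee eB by (auto simp: orthonormal_on_def)
      \<comment> \<open>The old vectors are combinations of \<open>B\<close>, hence orthogonal to
        \<open>e\<close>, so the enlarged basis leaves their expansions unchanged.\<close>
      have ex': "cinner e x' = 0" if "x' \<in> X" for x'
        by (subst B(3)[OF that]) (simp add: cinner_sum_right cinner_scaleC_right eb)
      have "cinner e x = cinner e y + cinner e (\<Sum>b\<in>B. cinner b x *\<^sub>C b)"
        by (simp add: y_def flip: cinner_add_right)
      also have "(cinner e (\<Sum>b\<in>B. cinner b x *\<^sub>C b)) = 0"
        by (simp add: cinner_sum_right cinner_scaleC_right eb)
      also have "cinner e y = complex_of_real (norm y)"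
        using False by (simp add: e_def cinner_scaleC_left cinner_self power2_eq_square)
      finally have "cinner e x *\<^sub>C e = y"
        using False by (simp add: e_def scaleC_scaleC)
      then have "x = (\<Sum>b\<in>insert e B. cinner b x *\<^sub>C b)"
        using B(1) eB by (simp add: y_def)
      moreover have "x' = (\<Sum>b\<in>insert e B. cinner b x' *\<^sub>C b)" if "x' \<in> X" for x'
        using B(1) eB B(3)[OF that] ex'[OF that] by simp
      ultimately show ?thesis
        using B(1) orth by (intro exI[of _ "insert e B"]) auto
    qed
  qed
  then show ?thesis using that by blast
qed

text \<open>Expanding the vectors in an orthonormal basis of their span splits the left side into scalar parts.\<close>

lemma scalar_matrix_amplification:
  fixes a :: "nat \<Rightarrow> nat \<Rightarrow> complex" and x :: "nat \<Rightarrow> 'h::chilbert_space"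
  assumes c: "0 \<le> c"
    and a: "\<And>\<xi>. L2_set (\<lambda>i. cmod (\<Sum>j<n. a i j * \<xi> j)) {..<n} \<le> c * L2_set (\<lambda>j. cmod (\<xi> j)) {..<n}"
  shows "L2_set (\<lambda>i. norm (\<Sum>j<n. a i j *\<^sub>C x j)) {..<n} \<le> c * L2_set (\<lambda>j. norm (x j)) {..<n}"
proof -
  obtain B where B: "finite B" "orthonormal_on B (\<lambda>b. b)"
    "\<And>y. y \<in> x ` {..<n} \<Longrightarrow> y = (\<Sum>b\<in>B. cinner b y *\<^sub>C b)"
    using finite_orthonormal_expansion[of "x ` {..<n}"] by blast
  have x: "(\<Sum>b\<in>B. cinner b (x j) *\<^sub>C b) = x j" if "j < n" for j
    using B(3)[of "x j"] that by simp
  have nx: "(norm (x j))\<^sup>2 = (\<Sum>b\<in>B. (cmod (cinner b (x j)))\<^sup>2)" if "j < n" for j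
    using norm_orthonormal_sum[OF B(2,1), of "\<lambda>b. cinner b (x j)"] x[OF that] by simp
  have "(\<Sum>i<n. (norm (\<Sum>j<n. a i j *\<^sub>C x j))\<^sup>2) = (\<Sum>i<n. \<Sum>b\<in>B. (cmod (\<Sum>j<n. a i j * cinner b (x j)))\<^sup>2)"
  proof (rule sum.cong[OF refl])
    fix i
    have "(\<Sum>j<n. a i j *\<^sub>C x j) = (\<Sum>j<n. a i j *\<^sub>C (\<Sum>b\<in>B. cinner b (x j) *\<^sub>C b))"
      by (simp add: x)
    also have "\<dots> = (\<Sum>b\<in>B. (\<Sum>j<n. a i j * cinner b (x j)) *\<^sub>C b)"
      unfolding complex_vector.scale_sum_right complex_vector.scale_sum_left scaleC_scaleC
      by (rule sum.swap)
    finally show "(norm (\<Sum>j<n. a i j *\<^sub>C x j))\<^sup>2 = (\<Sum>b\<in>B. (cmod (\<Sum>j<n. a i j * cinner b (x j)))\<^sup>2)"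
      using norm_orthonormal_sum[OF B(2,1)] by simp
  qed
  also have "\<dots> = (\<Sum>b\<in>B. \<Sum>i<n. (cmod (\<Sum>j<n. a i j * cinner b (x j)))\<^sup>2)"
    by (rule sum.swap)
  also have "\<dots> \<le> (\<Sum>b\<in>B. c\<^sup>2 * (\<Sum>j<n. (cmod (cinner b (x j)))\<^sup>2))"
  proof (rule sum_mono)
    fix b
    from power_mono[OF a[of "\<lambda>j. cinner b (x j)"] L2_set_nonneg, of 2]
    show "(\<Sum>i<n. (cmod (\<Sum>j<n. a i j * cinner b (x j)))\<^sup>2) \<le> c\<^sup>2 * (\<Sum>j<n. (cmod (cinner b (x j)))\<^sup>2)"
      by (simp add: L2_set_def power_mult_distrib sum_nonneg)
  qed
  also have "\<dots> = c\<^sup>2 * (\<Sum>j<n. (norm (x j))\<^sup>2)"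
    unfolding sum_distrib_left[symmetric] by (subst sum.swap) (simp add: nx)
  finally have "sqrt (\<Sum>i<n. (norm (\<Sum>j<n. a i j *\<^sub>C x j))\<^sup>2) \<le> sqrt (c\<^sup>2 * (\<Sum>j<n. (norm (x j))\<^sup>2))"
    by (rule real_sqrt_le_mono)
  then show ?thesis
    using c by (simp add: L2_set_def real_sqrt_mult)
qed


subsection \<open>Matrix norms and completely bounded maps\<close>

text \<open>A real \<open>Sup\<close> carries information only for a bounded set; the crude bound by
  the sum of all entry norms suffices.\<close>

lemma matrix_norm_set_bdd:
  fixes A :: "nat \<Rightarrow> nat \<Rightarrow> 'h::chilbert_space \<Rightarrow>\<^sub>L 'h" and n :: nat
  shows "bdd_above {L2_set (\<lambda>i. norm (\<Sum>j<n. blinfun_apply (A i j) (\<xi> j))) {..<n} |\<xi>.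
      L2_set (\<lambda>j. norm (\<xi> j)) {..<n} \<le> 1}"
proof (rule bdd_aboveI, clarify)
  fix \<xi> :: "nat \<Rightarrow> 'h"
  assume \<xi>: "L2_set (\<lambda>j. norm (\<xi> j)) {..<n} \<le> 1"
  have "L2_set (\<lambda>i. norm (\<Sum>j<n. blinfun_apply (A i j) (\<xi> j))) {..<n}
      \<le> (\<Sum>i<n. norm (\<Sum>j<n. blinfun_apply (A i j) (\<xi> j)))"
    by (rule L2_set_le_sum) simp
  also have "\<dots> \<le> (\<Sum>i<n. \<Sum>j<n. norm (A i j))"
  proof (intro sum_mono order.trans[OF norm_sum])
    fix i j assume "j \<in> {..<n}"
    then have "norm (\<xi> j) \<le> 1"
      using member_le_L2_set[of "{..<n}" j "\<lambda>j. norm (\<xi> j)"] \<xi> by simp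
    then show "norm (blinfun_apply (A i j) (\<xi> j)) \<le> norm (A i j)"
      using norm_blinfun[of "A i j" "\<xi> j"] by (meson mult_left_le norm_ge_zero order.trans)
  qed
  finally show "L2_set (\<lambda>i. norm (\<Sum>j<n. blinfun_apply (A i j) (\<xi> j))) {..<n} \<le> (\<Sum>i<n. \<Sum>j<n. norm (A i j))" .
qed

lemma matrix_norm_nonneg: "0 \<le> matrix_norm n A"
  unfolding matrix_norm_def
  by (rule cSup_upper[OF _ matrix_norm_set_bdd]) (auto intro!: exI[of _ "\<lambda>_. 0"] simp: L2_set_def)

text \<open>By homogeneity \<open>\<xi>\<close> may be scaled to norm one, and the zero vector is
  treated apart. With \<open>matrix_norm_le\<close> this identifies the supremum as the least
  admissible constant, so norm estimates become estimates for each \<open>\<xi>\<close>.\<close>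

lemma matrix_norm_apply:
  "L2_set (\<lambda>i. norm (\<Sum>j<n. blinfun_apply (A i j) (\<xi> j))) {..<n} \<le> matrix_norm n A * L2_set (\<lambda>j. norm (\<xi> j)) {..<n}"
proof (cases "L2_set (\<lambda>j. norm (\<xi> j)) {..<n} = 0")
  case True
  then have "\<xi> j = 0" if "j < n" for j
    using that by (simp add: L2_set_eq_0_iff)
  then show ?thesis using True by (simp add: L2_set_def)
next
  case False
  define r where "r = L2_set (\<lambda>j. norm (\<xi> j)) {..<n}"
  have r: "r > 0" using False L2_set_nonneg[of "\<lambda>j. norm (\<xi> j)" "{..<n}"] unfolding r_def by linarith
  have s: "L2_set (\<lambda>i. norm (inverse r *\<^sub>R f i)) {..<n} = inverse r * L2_set (\<lambda>i. norm (f i)) {..<n}"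
    for f :: "nat \<Rightarrow> 'a"
    using r by (simp add: L2_set_right_distrib)
  have "L2_set (\<lambda>j. norm (inverse r *\<^sub>R \<xi> j)) {..<n} \<le> 1"
    unfolding s using r by (simp add: r_def)
  then have "L2_set (\<lambda>i. norm (\<Sum>j<n. blinfun_apply (A i j) (inverse r *\<^sub>R \<xi> j))) {..<n} \<le> matrix_norm n A"
    unfolding matrix_norm_def
    by (intro cSup_upper[OF _ matrix_norm_set_bdd] CollectI exI[of _ "\<lambda>j. inverse r *\<^sub>R \<xi> j"] conjI refl)
  also have "L2_set (\<lambda>i. norm (\<Sum>j<n. blinfun_apply (A i j) (inverse r *\<^sub>R \<xi> j))) {..<n}
    = inverse r * L2_set (\<lambda>i. norm (\<Sum>j<n. blinfun_apply (A i j) (\<xi> j))) {..<n}"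
    unfolding blinfun.scaleR_right scaleR_sum_right[symmetric] s ..
  finally show ?thesis
    using r unfolding r_def[symmetric] by (simp add: field_simps)
qed

lemma matrix_norm_le:
  assumes "0 \<le> c"
    and "\<And>\<xi>. L2_set (\<lambda>i. norm (\<Sum>j<n. blinfun_apply (A i j) (\<xi> j))) {..<n} \<le> c * L2_set (\<lambda>j. norm (\<xi> j)) {..<n}"
  shows "matrix_norm n A \<le> c"
  unfolding matrix_norm_def
proof (rule cSup_least)
  show "{L2_set (\<lambda>i. norm (\<Sum>j<n. blinfun_apply (A i j) (\<xi> j))) {..<n} |\<xi>.
      L2_set (\<lambda>j. norm (\<xi> j)) {..<n} \<le> 1} \<noteq> {}"
    by (auto intro!: exI[of _ "\<lambda>_. 0"] simp: L2_set_def)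
  fix x assume "x \<in> {L2_set (\<lambda>i. norm (\<Sum>j<n. blinfun_apply (A i j) (\<xi> j))) {..<n} |\<xi>.
      L2_set (\<lambda>j. norm (\<xi> j)) {..<n} \<le> 1}"
  then obtain \<xi> where \<xi>: "x = L2_set (\<lambda>i. norm (\<Sum>j<n. blinfun_apply (A i j) (\<xi> j))) {..<n}"
     "L2_set (\<lambda>j. norm (\<xi> j)) {..<n} \<le> 1" by blast
  have "x \<le> c * L2_set (\<lambda>j. norm (\<xi> j)) {..<n}" using assms(2) \<xi>(1) by simp
  also have "\<dots> \<le> c" using \<xi>(2) assms(1) by (rule mult_left_le)
  finally show "x \<le> c" .
qed

lemma matrix_norm_add_le: "matrix_norm n (\<lambda>i j. A i j + B i j) \<le> matrix_norm n A + matrix_norm n B"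
proof (rule matrix_norm_le)
  fix \<xi> :: "nat \<Rightarrow> 'a"
  have "L2_set (\<lambda>i. norm (\<Sum>j<n. blinfun_apply (A i j + B i j) (\<xi> j))) {..<n}
     \<le> L2_set (\<lambda>i. norm (\<Sum>j<n. blinfun_apply (A i j) (\<xi> j)) + norm (\<Sum>j<n. blinfun_apply (B i j) (\<xi> j))) {..<n}"
    by (intro L2_set_mono) (auto simp: blinfun.add_left sum.distrib norm_triangle_ineq)
  also note L2_set_triangle_ineq
  also note add_mono[OF matrix_norm_apply matrix_norm_apply]
  finally show "L2_set (\<lambda>i. norm (\<Sum>j<n. blinfun_apply (A i j + B i j) (\<xi> j))) {..<n}
    \<le> (matrix_norm n A + matrix_norm n B) * L2_set (\<lambda>j. norm (\<xi> j)) {..<n}"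
    by (simp add: distrib_right)
qed (simp add: matrix_norm_nonneg)

lemma matrix_norm_zero: "matrix_norm n (\<lambda>i j. 0) = 0"
  by (intro antisym matrix_norm_nonneg matrix_norm_le) (simp_all add: L2_set_def)

lemma matrix_norm_sum_le:
  "matrix_norm n (\<lambda>i j. \<Sum>k\<in>K. A k i j) \<le> (\<Sum>k\<in>K. matrix_norm n (A k))"
proof (induction K rule: infinite_finite_induct)
  case (insert k K)
  then show ?case
    using matrix_norm_add_le[of n "A k" "\<lambda>i j. \<Sum>k\<in>K. A k i j"] by simp
qed (simp_all add: matrix_norm_zero)

text \<open>Testing on a vector supported in coordinate \<open>j\<close> and reading off coordinate
  \<open>i\<close> isolates the entry.\<close>

lemma norm_entry_le_matrix_norm:
  fixes A :: "nat \<Rightarrow> nat \<Rightarrow> 'h::chilbert_space \<Rightarrow>\<^sub>L 'h"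
  assumes "i < n" "j < n"
  shows "norm (A i j) \<le> matrix_norm n A"
proof (rule norm_blinfun_bound[OF matrix_norm_nonneg])
  fix h :: 'h
  define \<xi> where "\<xi> = (\<lambda>l::nat. if l = j then h else 0)"
  have "norm (blinfun_apply (A i j) h) = norm (\<Sum>l<n. blinfun_apply (A i l) (\<xi> l))"
    using assms by (simp add: \<xi>_def if_distrib[of "blinfun_apply _"] cong: if_cong)
  also have "\<dots> \<le> L2_set (\<lambda>i. norm (\<Sum>l<n. blinfun_apply (A i l) (\<xi> l))) {..<n}"
    using assms by (intro member_le_L2_set) auto
  also have "\<dots> \<le> matrix_norm n A * L2_set (\<lambda>j. norm (\<xi> j)) {..<n}"
    by (rule matrix_norm_apply)
  also have "L2_set (\<lambda>j. norm (\<xi> j)) {..<n} = norm h"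
    using assms by (simp add: L2_set_def \<xi>_def if_distrib[of norm] if_distrib[of "\<lambda>x. x\<^sup>2"] cong: if_cong)
  finally show "norm (blinfun_apply (A i j) h) \<le> matrix_norm n A * norm h" .
qed

lemma matrix_norm_1: "matrix_norm 1 (\<lambda>i j. v) = norm v"
proof (rule antisym)
  show "matrix_norm 1 (\<lambda>i j. v) \<le> norm v"
    by (rule matrix_norm_le) (simp_all add: L2_set_def norm_blinfun)
  show "norm v \<le> matrix_norm 1 (\<lambda>i j. v)"
    using norm_entry_le_matrix_norm[of 0 1 0 "\<lambda>i j. v"] by simp
qed

lemma matrix_norm_cong:
  assumes "\<And>i j. i < n \<Longrightarrow> j < n \<Longrightarrow> A i j = B i j"
  shows "matrix_norm n A = matrix_norm n B"
proof -
  have "L2_set (\<lambda>i. norm (\<Sum>j<n. blinfun_apply (A i j) (\<xi> j))) {..<n}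
      = L2_set (\<lambda>i. norm (\<Sum>j<n. blinfun_apply (B i j) (\<xi> j))) {..<n}" for \<xi>
    using assms by (intro L2_set_cong) auto
  then show ?thesis unfolding matrix_norm_def by simp
qed

lemma matrix_norm_scaleR: "0 \<le> r \<Longrightarrow> matrix_norm n (\<lambda>i j. r *\<^sub>R A i j) \<le> r * matrix_norm n A"
proof (rule matrix_norm_le)
  fix \<xi> :: "nat \<Rightarrow> 'a"
  assume r: "0 \<le> r"
  have "L2_set (\<lambda>i. norm (\<Sum>j<n. blinfun_apply (r *\<^sub>R A i j) (\<xi> j))) {..<n}
      = r * L2_set (\<lambda>i. norm (\<Sum>j<n. blinfun_apply (A i j) (\<xi> j))) {..<n}"
    using r by (simp add: blinfun.scaleR_left L2_set_right_distrib flip: scaleR_sum_right)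
  also have "\<dots> \<le> r * (matrix_norm n A * L2_set (\<lambda>j. norm (\<xi> j)) {..<n})"
    using r by (intro mult_left_mono matrix_norm_apply)
  finally show "L2_set (\<lambda>i. norm (\<Sum>j<n. blinfun_apply (r *\<^sub>R A i j) (\<xi> j))) {..<n}
    \<le> r * matrix_norm n A * L2_set (\<lambda>j. norm (\<xi> j)) {..<n}" by simp
qed (simp add: matrix_norm_nonneg)

text \<open>A homogeneous form of the cb bound with a real constant: it needs no normalisation of
  the matrix, and constants multiply under composition without arithmetic in
  \<open>ennreal\<close>.\<close>

definition cb_bounded_by ::
  "('h::chilbert_space \<Rightarrow>\<^sub>L 'h) set \<Rightarrow> (('h \<Rightarrow>\<^sub>L 'h) \<Rightarrow> ('k::chilbert_space \<Rightarrow>\<^sub>L 'k)) \<Rightarrow> real \<Rightarrow> bool"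
  where "cb_bounded_by V T c \<longleftrightarrow>
    (\<forall>n A. (\<forall>i<n. \<forall>j<n. A i j \<in> V) \<longrightarrow> matrix_norm n (\<lambda>i j. T (A i j)) \<le> c * matrix_norm n A)"

lemma cb_bounded_byD:
  "cb_bounded_by V T c \<Longrightarrow> (\<And>i j. i < n \<Longrightarrow> j < n \<Longrightarrow> A i j \<in> V) \<Longrightarrow>
    matrix_norm n (\<lambda>i j. T (A i j)) \<le> c * matrix_norm n A"
  unfolding cb_bounded_by_def by blast

lemma cb_bounded_by_norm: "cb_bounded_by V T c \<Longrightarrow> v \<in> V \<Longrightarrow> norm (T v) \<le> c * norm v"
  using cb_bounded_byD[of V T c 1 "\<lambda>i j. v"] unfolding matrix_norm_1 by simp

lemma cb_norm_le_imp_cb_bounded_by: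
  fixes T :: "('h::chilbert_space \<Rightarrow>\<^sub>L 'h) \<Rightarrow> ('k::chilbert_space \<Rightarrow>\<^sub>L 'k)"
  assumes V: "csubspace V" and T: "clinear_on V T" and c: "0 \<le> c" "cb_norm V T \<le> ennreal c"
  shows "cb_bounded_by V T c"
  unfolding cb_bounded_by_def
proof (intro allI impI)
  fix n :: nat and A :: "nat \<Rightarrow> nat \<Rightarrow> 'h \<Rightarrow>\<^sub>L 'h" assume A: "\<forall>i<n. \<forall>j<n. A i j \<in> V"
  define t where "t = matrix_norm n A"
  show "matrix_norm n (\<lambda>i j. T (A i j)) \<le> c * matrix_norm n A"
  proof (cases "t = 0")
    \<comment> \<open>A matrix of norm zero cannot be normalised, but all its relevant entries
      vanish and linearity gives the claim.\<close>
    case True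
    then have "A i j = 0" if "i < n" "j < n" for i j
      using norm_entry_le_matrix_norm[OF that, of A] by (simp add: t_def)
    then have "matrix_norm n (\<lambda>i j. T (A i j)) = matrix_norm n (\<lambda>i j. 0::'k \<Rightarrow>\<^sub>L 'k)"
      by (intro matrix_norm_cong) (simp add: clinear_on_0[OF V T])
    then show ?thesis
      using c matrix_norm_nonneg[of n A] by (simp add: matrix_norm_zero)
  next
    case False
    then have t: "t > 0" using matrix_norm_nonneg[of n A] by (simp add: t_def)
    define B where "B = (\<lambda>i j. inverse t *\<^sub>R A i j)"
    have BV: "\<forall>i<n. \<forall>j<n. B i j \<in> V"
      using A by (simp add: B_def scaleR_scaleC complex_vector.subspace_scale[OF V])
    have "matrix_norm n B \<le> 1"
      using matrix_norm_scaleR[of "inverse t" n A] t by (simp add: B_def t_def)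
    then have "ennreal (matrix_norm n (\<lambda>i j. T (B i j))) \<le> cb_norm V T"
      unfolding cb_norm_def using BV by (intro SUP_upper2[of n] SUP_upper2[of B]) auto
    then have "ennreal (matrix_norm n (\<lambda>i j. T (B i j))) \<le> ennreal c"
      using c(2) by (rule order.trans)
    then have TB: "matrix_norm n (\<lambda>i j. T (B i j)) \<le> c"
      using c(1) by (simp add: ennreal_le_iff)
    have "matrix_norm n (\<lambda>i j. T (A i j)) = matrix_norm n (\<lambda>i j. t *\<^sub>R T (B i j))"
      using t A by (intro matrix_norm_cong)
        (simp add: B_def scaleR_scaleC scaleC_scaleC clinear_on_scaleC[OF T])
    also have "\<dots> \<le> t * matrix_norm n (\<lambda>i j. T (B i j))"
      using t by (intro matrix_norm_scaleR) simp
    also have "\<dots> \<le> t * c"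
      using t TB by (intro mult_left_mono) auto
    finally show ?thesis by (simp add: t_def mult.commute)
  qed
qed

lemma cb_norm_finite_imp_cb_bounded_by:
  assumes "csubspace V" "clinear_on V T" "cb_norm V T < \<infinity>"
  obtains c where "0 \<le> c" "cb_bounded_by V T c"
proof (rule that[of "enn2real (cb_norm V T)"])
  show "cb_bounded_by V T (enn2real (cb_norm V T))"
    using assms by (intro cb_norm_le_imp_cb_bounded_by) auto
qed simp

lemma cb_bounded_by_imp_cb_norm:
  assumes "0 \<le> c" "cb_bounded_by V T c"
  shows "cb_norm V T < \<infinity>"
proof -
  have "cb_norm V T \<le> ennreal c"
    unfolding cb_norm_def
  proof (intro SUP_least)
    fix n and A :: "nat \<Rightarrow> nat \<Rightarrow> 'a \<Rightarrow>\<^sub>L 'a" assume A: "A \<in> {A. (\<forall>i<n. \<forall>j<n. A i j \<in> V) \<and> matrix_norm n A \<le> 1}"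
    have "matrix_norm n (\<lambda>i j. T (A i j)) \<le> c * matrix_norm n A"
      using A by (intro cb_bounded_byD[OF assms(2)]) auto
    also have "\<dots> \<le> c" using A assms(1) by (auto intro: mult_left_le)
    finally show "ennreal (matrix_norm n (\<lambda>i j. T (A i j))) \<le> ennreal c" by (rule ennreal_leI)
  qed
  then show ?thesis by (rule order.strict_trans1) simp
qed

section \<open>Complete boundedness of functionals and of rank-one maps\<close>

lemma norm_sum_scaleC_le_L2_set:
  fixes \<eta> :: "nat \<Rightarrow> complex" and v :: "nat \<Rightarrow> 'a::complex_normed_vector"
  shows "norm (\<Sum>i<n. \<eta> i *\<^sub>C v i) \<le> L2_set (\<lambda>i. cmod (\<eta> i)) {..<n} * L2_set (\<lambda>i. norm (v i)) {..<n}"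
proof -
  have "norm (\<Sum>i<n. \<eta> i *\<^sub>C v i) \<le> (\<Sum>i<n. \<bar>cmod (\<eta> i)\<bar> * \<bar>norm (v i)\<bar>)"
    using norm_sum[of "\<lambda>i. \<eta> i *\<^sub>C v i"] by (simp add: norm_scaleC)
  also note L2_set_mult_ineq
  finally show ?thesis .
qed

text \<open>
  Testing the scalar matrix \<open>(\<phi> (A i j))\<close> against vectors \<open>\<eta>\<close>, \<open>\<xi>\<close> gives the value of \<open>\<phi>\<close> at the
  compression of \<open>A\<close> by \<open>\<eta>\<close> and \<open>\<xi>\<close>; so bounded functionals are automatically completely bounded.
\<close>

lemma functional_matrix_bound:
  assumes V: "csubspace V" "V \<subseteq> bounded_ops" and \<phi>: "clinear_on V \<phi>" "\<And>v. v \<in> V \<Longrightarrow> cmod (\<phi> v) \<le> c * norm v"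
    and c: "0 \<le> c" and A: "\<And>i j. i < n \<Longrightarrow> j < n \<Longrightarrow> A i j \<in> V"
  shows "L2_set (\<lambda>i. cmod (\<Sum>j<n. \<phi> (A i j) * \<xi> j)) {..<n} \<le> c * matrix_norm n A * L2_set (\<lambda>j. cmod (\<xi> j)) {..<n}"
proof -
  \<comment> \<open>The test vector is the image \<open>\<zeta>\<close> of \<open>\<xi>\<close>
    itself. The value of \<open>\<phi>\<close> at the compression \<open>w\<close> is then the
    square of the norm \<open>Z\<close> to be estimated, and one factor \<open>Z\<close> cancels at
    the end.\<close>
  define \<zeta> where "\<zeta> = (\<lambda>i. \<Sum>j<n. \<phi> (A i j) * \<xi> j)"
  define Z where "Z = L2_set (\<lambda>i. cmod (\<zeta> i)) {..<n}"
  define w where "w = (\<Sum>i<n. \<Sum>j<n. (cnj (\<zeta> i) * \<xi> j) *\<^sub>C A i j)"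
  have wV: "w \<in> V"
    unfolding w_def using A by (auto intro!: complex_vector.subspace_sum complex_vector.subspace_scale V)
  have "norm w \<le> Z * matrix_norm n A * L2_set (\<lambda>j. cmod (\<xi> j)) {..<n}"
  proof (rule norm_blinfun_bound)
    show "0 \<le> Z * matrix_norm n A * L2_set (\<lambda>j. cmod (\<xi> j)) {..<n}"
      by (simp add: Z_def matrix_norm_nonneg)
    fix h
    have "blinfun_apply w h = (\<Sum>i<n. \<Sum>j<n. (cnj (\<zeta> i) * \<xi> j) *\<^sub>C blinfun_apply (A i j) h)"
      by (simp add: w_def blinfun.sum_left scaleC_blinfun.rep_eq)
    also have "\<dots> = (\<Sum>i<n. cnj (\<zeta> i) *\<^sub>C (\<Sum>j<n. blinfun_apply (A i j) (\<xi> j *\<^sub>C h)))"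
      unfolding complex_vector.scale_sum_right scaleC_scaleC[symmetric]
    proof (intro sum.cong refl arg_cong[where f="scaleC _"])
      fix i j assume "i \<in> {..<n}" "j \<in> {..<n}"
      \<comment> \<open>Elements of the type are only real linear; moving the complex scalar
        \<open>\<xi> j\<close> inside requires an entry from \<open>bounded_ops\<close>.\<close>
      then have "A i j \<in> bounded_ops" using A V(2) by auto
      then show "\<xi> j *\<^sub>C blinfun_apply (A i j) h = blinfun_apply (A i j) (\<xi> j *\<^sub>C h)"
        by (simp add: bounded_ops_def clinear_on_def)
    qed
    finally have "norm (blinfun_apply w h)
      \<le> L2_set (\<lambda>i. cmod (cnj (\<zeta> i))) {..<n} * L2_set (\<lambda>i. norm (\<Sum>j<n. blinfun_apply (A i j) (\<xi> j *\<^sub>C h))) {..<n}"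
      using norm_sum_scaleC_le_L2_set[of "\<lambda>i. cnj (\<zeta> i)"] by simp
    also have "\<dots> \<le> Z * (matrix_norm n A * L2_set (\<lambda>j. norm (\<xi> j *\<^sub>C h)) {..<n})"
      unfolding Z_def by (simp add: mult_left_mono matrix_norm_apply)
    also have "L2_set (\<lambda>j. norm (\<xi> j *\<^sub>C h)) {..<n} = L2_set (\<lambda>j. cmod (\<xi> j)) {..<n} * norm h"
      by (simp add: norm_scaleC L2_set_left_distrib)
    finally show "norm (blinfun_apply w h) \<le> Z * matrix_norm n A * L2_set (\<lambda>j. cmod (\<xi> j)) {..<n} * norm h"
      by (simp add: mult.assoc)
  qed
  have "\<phi> w = (\<Sum>i<n. \<Sum>j<n. (cnj (\<zeta> i) * \<xi> j) * \<phi> (A i j))"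
  proof -
    have "\<phi> w = (\<Sum>i<n. \<phi> (\<Sum>j<n. (cnj (\<zeta> i) * \<xi> j) *\<^sub>C A i j))"
      unfolding w_def using A
      by (intro clinear_on_sum[OF V(1) \<phi>(1)] complex_vector.subspace_sum[OF V(1)]
          complex_vector.subspace_scale[OF V(1)]) auto
    also have "\<dots> = (\<Sum>i<n. \<Sum>j<n. \<phi> ((cnj (\<zeta> i) * \<xi> j) *\<^sub>C A i j))"
      using A by (intro sum.cong refl clinear_on_sum[OF V(1) \<phi>(1)] complex_vector.subspace_scale[OF V(1)]) auto
    also have "\<dots> = (\<Sum>i<n. \<Sum>j<n. (cnj (\<zeta> i) * \<xi> j) * \<phi> (A i j))"
      using A by (intro sum.cong refl) (simp add: clinear_on_scaleC[OF \<phi>(1)] scaleC_complex_def)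
    finally show ?thesis .
  qed
  also have "\<dots> = (\<Sum>i<n. cnj (\<zeta> i) * (\<Sum>j<n. \<phi> (A i j) * \<xi> j))"
    by (simp add: sum_distrib_left mult_ac)
  also have "\<dots> = (\<Sum>i<n. cnj (\<zeta> i) * \<zeta> i)"
    by (simp add: \<zeta>_def)
  also have "\<dots> = complex_of_real (\<Sum>i<n. (cmod (\<zeta> i))\<^sup>2)"
    by (simp add: complex_norm_square mult.commute del: of_real_power)
  also have "(\<Sum>i<n. (cmod (\<zeta> i))\<^sup>2) = Z\<^sup>2"
    by (simp add: Z_def L2_set_def sum_nonneg)
  finally have "Z\<^sup>2 = cmod (\<phi> w)"
    by (simp del: of_real_power)
  also have "\<dots> \<le> c * norm w" by (rule \<phi>(2)[OF wV])
  also have "\<dots> \<le> c * (Z * matrix_norm n A * L2_set (\<lambda>j. cmod (\<xi> j)) {..<n})"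
    by (intro mult_left_mono c) fact
  finally have Z2: "Z * Z \<le> Z * (c * matrix_norm n A * L2_set (\<lambda>j. cmod (\<xi> j)) {..<n})"
    by (simp add: power2_eq_square mult_ac)
  have "Z \<le> c * matrix_norm n A * L2_set (\<lambda>j. cmod (\<xi> j)) {..<n}"
  proof (cases "Z = 0")
    case True then show ?thesis using c by (simp add: matrix_norm_nonneg)
  next
    case False
    then have "Z > 0" using L2_set_nonneg[of "\<lambda>i. cmod (\<zeta> i)" "{..<n}"] unfolding Z_def by linarith
    then show ?thesis using Z2 by simp
  qed
  then show ?thesis by (simp add: Z_def \<zeta>_def)
qed

lemma L2_set_blinfun_le:
  "L2_set (\<lambda>i. norm (blinfun_apply y (x i))) I \<le> norm y * L2_set (\<lambda>i. norm (x i)) I"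
  unfolding L2_set_right_distrib[OF norm_ge_zero]
  by (rule L2_set_mono) (auto simp: norm_blinfun)

text \<open>The matrix of all \<open>\<phi> (A i j) *\<^sub>C d\<close> acts as the scalar matrix of
  all \<open>\<phi> (A i j)\<close> on the vectors \<open>d (\<xi> j)\<close>. The scalar matrix
  keeps its bound on Hilbert space vectors, and \<open>d\<close> contributes its norm.\<close>

lemma rank_one_cb_bounded_by:
  fixes V :: "('h::chilbert_space \<Rightarrow>\<^sub>L 'h) set" and d :: "'k::chilbert_space \<Rightarrow>\<^sub>L 'k"
  assumes V: "csubspace V" "V \<subseteq> bounded_ops" and \<phi>: "clinear_on V \<phi>" "\<And>v. v \<in> V \<Longrightarrow> cmod (\<phi> v) \<le> c * norm v"
    and c: "0 \<le> c"
  shows "cb_bounded_by V (\<lambda>v. \<phi> v *\<^sub>C d) (c * norm d)"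
  unfolding cb_bounded_by_def
proof (intro allI impI)
  fix n :: nat and A :: "nat \<Rightarrow> nat \<Rightarrow> 'h \<Rightarrow>\<^sub>L 'h" assume A: "\<forall>i<n. \<forall>j<n. A i j \<in> V"
  show "matrix_norm n (\<lambda>i j. \<phi> (A i j) *\<^sub>C d) \<le> c * norm d * matrix_norm n A"
  proof (rule matrix_norm_le)
    show "0 \<le> c * norm d * matrix_norm n A" using c by (simp add: matrix_norm_nonneg)
    fix \<xi> :: "nat \<Rightarrow> 'k"
    have "L2_set (\<lambda>i. norm (\<Sum>j<n. blinfun_apply (\<phi> (A i j) *\<^sub>C d) (\<xi> j))) {..<n}
      \<le> c * matrix_norm n A * L2_set (\<lambda>j. norm (blinfun_apply d (\<xi> j))) {..<n}"
      unfolding scaleC_blinfun.rep_eq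
      using A c by (intro scalar_matrix_amplification functional_matrix_bound[OF V \<phi> c])
        (auto simp: matrix_norm_nonneg)
    also have "\<dots> \<le> c * matrix_norm n A * (norm d * L2_set (\<lambda>j. norm (\<xi> j)) {..<n})"
      using c by (intro mult_left_mono L2_set_blinfun_le) (simp add: matrix_norm_nonneg)
    finally show "L2_set (\<lambda>i. norm (\<Sum>j<n. blinfun_apply (\<phi> (A i j) *\<^sub>C d) (\<xi> j))) {..<n}
      \<le> c * norm d * matrix_norm n A * L2_set (\<lambda>j. norm (\<xi> j)) {..<n}" by (simp add: mult_ac)
  qed
qed


subsection \<open>Operators on sequence spaces as infinite matrices\<close>

lift_definition ell2_single :: "nat \<Rightarrow> 'a::real_normed_vector \<Rightarrow> 'a ell2"
  is "\<lambda>j h n. if n = j then h else 0"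
proof -
  show "summable (\<lambda>n. (norm (if n = j then h else (0::'a)))\<^sup>2)" for j :: nat and h
    by (rule summable_finite[of "{j}"]) auto
qed

lemma ell2_eqI: "(\<And>n. ell2_nth x n = ell2_nth y n) \<Longrightarrow> x = y"
  by (simp add: ell2_nth_inject[symmetric] fun_eq_iff)

lemma bounded_linear_ell2_nth: "bounded_linear (\<lambda>x. ell2_nth x n)"
  by (rule bounded_linear_intro[where K=1])
    (simp_all add: plus_ell2.rep_eq scaleR_ell2.rep_eq norm_ell2_nth_le)

lemmas ell2_nth_sum = linear_sum[OF bounded_linear.linear[OF bounded_linear_ell2_nth]]

lemma ell2_nth_sum_single:
  "ell2_nth (\<Sum>j<N. ell2_single j (\<xi> j)) n = (if n < N then \<xi> n else 0)"
  by (simp add: ell2_nth_sum ell2_single.rep_eq)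

lemma norm_sum_ell2_single:
  "norm (\<Sum>j<N. ell2_single j (\<xi> j)) = L2_set (\<lambda>j. norm (\<xi> j)) {..<N}"
proof -
  have "(\<Sum>n. (norm (ell2_nth (\<Sum>j<N. ell2_single j (\<xi> j)) n))\<^sup>2) = (\<Sum>n<N. (norm (\<xi> n))\<^sup>2)"
    unfolding ell2_nth_sum_single by (subst suminf_finite[of "{..<N}"]) auto
  then show ?thesis by (simp add: norm_ell2_def L2_set_def)
qed

lemma norm_ell2_single: "norm (ell2_single j h) = norm h"
proof -
  have "(\<Sum>n. (norm (ell2_nth (ell2_single j h) n))\<^sup>2) = (norm h)\<^sup>2"
    unfolding ell2_single.rep_eq by (subst suminf_finite[of "{j}"]) auto
  then show ?thesis by (simp add: norm_ell2_def)
qed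

lemma bounded_linear_ell2_single: "bounded_linear (ell2_single j)"
  by (rule bounded_linear_intro[where K=1])
    (auto simp: norm_ell2_single intro!: ell2_eqI simp: plus_ell2.rep_eq scaleR_ell2.rep_eq ell2_single.rep_eq)

text \<open>The norm of the remainder is the square root of a tail of a convergent series.\<close>

lemma ell2_sums_single: "(\<lambda>j. ell2_single j (ell2_nth x j)) sums x"
proof -
  define s where "s = (\<lambda>n. (norm (ell2_nth x n))\<^sup>2)"
  have s: "summable s" unfolding s_def by (rule summable_ell2_nth)
  have eq: "norm ((\<Sum>j<N. ell2_single j (ell2_nth x j)) - x) = sqrt (suminf s - (\<Sum>n<N. s n))" for N
  proof -
    define t where "t = (\<lambda>n. if n < N then 0 else s n)"
    have "suminf t = suminf s - (\<Sum>n<N. s n)"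
    proof (rule sums_unique[symmetric])
      show "t sums (suminf s - (\<Sum>n<N. s n))"
      proof -
        have "(\<lambda>n. if n \<in> {..<N} then s n else 0) sums (\<Sum>n<N. s n)"
          by (rule sums_If_finite_set) simp
        from sums_diff[OF summable_sums[OF s] this] show ?thesis
          by (rule sums_cong[THEN iffD1, rotated]) (simp add: t_def)
      qed
    qed
    moreover have "(norm (ell2_nth ((\<Sum>j<N. ell2_single j (ell2_nth x j)) - x) n))\<^sup>2 = t n" for n
      by (simp add: minus_ell2.rep_eq ell2_nth_sum_single t_def s_def)
    ultimately show ?thesis by (simp add: norm_ell2_def)
  qed
  have "(\<lambda>N. sqrt (suminf s - (\<Sum>n<N. s n))) \<longlonglongrightarrow> sqrt (suminf s - suminf s)"
    by (intro tendsto_intros summable_LIMSEQ s)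
  then show ?thesis
    unfolding sums_def by - (rule LIM_zero_cancel, rule tendsto_norm_zero_cancel, simp add: eq)
qed

text \<open>An operator on \<open>'h ell2\<close>, the Hilbert tensor product of the sequence space
  with \<open>H\<close>, is treated as an infinite matrix of operators on \<open>H\<close>. The
  tensor product of a map with the identity then becomes the entrywise application of the
  map.\<close>

definition ell2_entry :: "('h::real_normed_vector ell2 \<Rightarrow>\<^sub>L 'h ell2) \<Rightarrow> nat \<Rightarrow> nat \<Rightarrow> 'h \<Rightarrow>\<^sub>L 'h"
  where "ell2_entry u i j = Blinfun (\<lambda>h. ell2_nth (blinfun_apply u (ell2_single j h)) i)"

lemma ell2_entry_apply:
  "blinfun_apply (ell2_entry u i j) h = ell2_nth (blinfun_apply u (ell2_single j h)) i"
  unfolding ell2_entry_def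
  by (subst bounded_linear_Blinfun_apply)
    (intro bounded_linear_compose[OF bounded_linear_ell2_nth]
      bounded_linear_compose[OF blinfun.bounded_linear_right] bounded_linear_ell2_single, rule refl)

lemma ell2_entry_add: "ell2_entry (u + w) i j = ell2_entry u i j + ell2_entry w i j"
  by (rule blinfun_eqI) (simp add: ell2_entry_apply blinfun.add_left plus_ell2.rep_eq)

lemma ell2_entry_scaleC: "ell2_entry (a *\<^sub>C u) i j = a *\<^sub>C ell2_entry u i j"
  by (rule blinfun_eqI) (simp add: ell2_entry_apply scaleC_blinfun.rep_eq scaleC_ell2.rep_eq)

lemma norm_ell2_entry_le: "norm (ell2_entry u i j) \<le> norm u"
proof (rule norm_blinfun_bound)
  fix h
  have "norm (ell2_nth (blinfun_apply u (ell2_single j h)) i) \<le> norm (blinfun_apply u (ell2_single j h))"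
    by (rule norm_ell2_nth_le)
  also have "\<dots> \<le> norm u * norm (ell2_single j h)" by (rule norm_blinfun)
  finally show "norm (blinfun_apply (ell2_entry u i j) h) \<le> norm u * norm h"
    by (simp add: ell2_entry_apply norm_ell2_single)
qed simp

lemma bounded_linear_ell2_entry: "bounded_linear (\<lambda>u::'h::complex_normed_vector ell2 \<Rightarrow>\<^sub>L 'h ell2. ell2_entry u i j)"
  by (rule bounded_linear_intro[where K=1])
    (simp_all add: ell2_entry_add ell2_entry_scaleC scaleR_scaleC norm_ell2_entry_le)

lemma sums_ell2_entry:
  "(\<lambda>j. blinfun_apply (ell2_entry u i j) (ell2_nth x j)) sums ell2_nth (blinfun_apply u x) i"
  unfolding ell2_entry_apply
  by (intro bounded_linear.sums[OF bounded_linear_ell2_nth]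
      bounded_linear.sums[OF blinfun.bounded_linear_right] ell2_sums_single)

text \<open>By continuity each coordinate of \<open>u x\<close> is the sum of a series that involves
  only the entries of \<open>u\<close>.\<close>

lemma ell2_entry_eqI:
  assumes "\<And>i j. ell2_entry u i j = ell2_entry w i j"
  shows "u = w"
proof (intro blinfun_eqI ell2_eqI)
  fix x i
  show "ell2_nth (blinfun_apply u x) i = ell2_nth (blinfun_apply w x) i"
    using sums_ell2_entry[of u i x] sums_ell2_entry[of w i x] by (simp add: assms sums_unique2)
qed

text \<open>The truncated matrix is the compression of \<open>u\<close> to the first
  \<open>n\<close> coordinates, seen on finitely supported sequences.\<close>

lemma ell2_entry_matrix_bound:
  "L2_set (\<lambda>i. norm (\<Sum>j<n. blinfun_apply (ell2_entry u i j) (\<xi> j))) {..<n}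
    \<le> norm u * L2_set (\<lambda>j. norm (\<xi> j)) {..<n}"
proof -
  define x where "x = (\<Sum>j<n. ell2_single j (\<xi> j))"
  have "ell2_nth (blinfun_apply u x) i = (\<Sum>j<n. blinfun_apply (ell2_entry u i j) (\<xi> j))" for i
    by (simp add: x_def blinfun.sum_right ell2_nth_sum ell2_entry_apply)
  then have "L2_set (\<lambda>i. norm (\<Sum>j<n. blinfun_apply (ell2_entry u i j) (\<xi> j))) {..<n} \<le> norm (blinfun_apply u x)"
    using L2_set_le_norm_ell2[of "blinfun_apply u x" n] by simp
  also have "\<dots> \<le> norm u * norm x" by (rule norm_blinfun)
  finally show ?thesis by (simp add: x_def norm_sum_ell2_single)
qed

text \<open>The matrix is applied to the truncations of a sequence. The uniform bound controls
  differences of these images by blocks of the square sum of the sequence, so they form a Cauchy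
  sequence whose limit defines the operator.\<close>

lemma ell2_operator_of_matrix:
  fixes w :: "nat \<Rightarrow> nat \<Rightarrow> 'h::banach \<Rightarrow>\<^sub>L 'h"
  assumes C: "0 \<le> C"
    and w: "\<And>n \<xi>. L2_set (\<lambda>i. norm (\<Sum>j<n. blinfun_apply (w i j) (\<xi> j))) {..<n} \<le> C * L2_set (\<lambda>j. norm (\<xi> j)) {..<n}"
  obtains u where "\<And>i j. ell2_entry u i j = w i j" "norm u \<le> C"
proof -
  define y where "y = (\<lambda>N \<xi>. Abs_ell2 (\<lambda>i. \<Sum>j<N. blinfun_apply (w i j) (\<xi> j)))"
  \<comment> \<open>The hypothesis concerns square blocks; padding \<open>\<xi>\<close> with zeros
    up to the larger dimension \<open>K\<close> gives rectangular ones.\<close>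
  have bnd: "L2_set (\<lambda>i. norm (\<Sum>j<N. blinfun_apply (w i j) (\<xi> j))) {..<M} \<le> C * L2_set (\<lambda>j. norm (\<xi> j)) {..<N}" for N M \<xi>
  proof -
    define \<zeta> where "\<zeta> = (\<lambda>j. if j < N then \<xi> j else 0)"
    define K where "K = max N M"
    have 1: "(\<Sum>j<K. blinfun_apply (w i j) (\<zeta> j)) = (\<Sum>j<N. blinfun_apply (w i j) (\<xi> j))" for i
      by (rule sum.mono_neutral_cong_right) (auto simp: K_def \<zeta>_def)
    have 2: "(\<Sum>j<K. (norm (\<zeta> j))\<^sup>2) = (\<Sum>j<N. (norm (\<xi> j))\<^sup>2)"
      by (rule sum.mono_neutral_cong_right) (auto simp: K_def \<zeta>_def)
    have "L2_set (\<lambda>i. norm (\<Sum>j<N. blinfun_apply (w i j) (\<xi> j))) {..<M} \<le> L2_set (\<lambda>i. norm (\<Sum>j<N. blinfun_apply (w i j) (\<xi> j))) {..<K}"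
      unfolding L2_set_def by (intro real_sqrt_le_mono sum_mono2) (auto simp: K_def)
    also have "\<dots> \<le> C * L2_set (\<lambda>j. norm (\<zeta> j)) {..<K}"
      using w[where n=K and \<xi>=\<zeta>] unfolding 1 .
    finally show ?thesis by (simp add: L2_set_def 2)
  qed
  have nth_y: "ell2_nth (y N \<xi>) i = (\<Sum>j<N. blinfun_apply (w i j) (\<xi> j))" for N \<xi> i
  proof -
    have "summable (\<lambda>i. (norm (\<Sum>j<N. blinfun_apply (w i j) (\<xi> j)))\<^sup>2)"
    proof (rule summableI_nonneg_bounded)
      show "(\<Sum>i<M. (norm (\<Sum>j<N. blinfun_apply (w i j) (\<xi> j)))\<^sup>2) \<le> (C * L2_set (\<lambda>j. norm (\<xi> j)) {..<N})\<^sup>2" for M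
        using bnd[where N=N and M=M and \<xi>=\<xi>] unfolding L2_set_def by (rule sqrt_le_D)
    qed simp
    then show ?thesis unfolding y_def by (simp add: Abs_ell2_inverse)
  qed
  have norm_y: "norm (y N \<xi>) \<le> C * L2_set (\<lambda>j. norm (\<xi> j)) {..<N}" for N \<xi>
    by (rule norm_ell2_le) (simp only: nth_y bnd)
  have diff_y: "norm (y M \<xi> - y N \<xi>) \<le> C * sqrt ((\<Sum>j<M. (norm (\<xi> j))\<^sup>2) - (\<Sum>j<N. (norm (\<xi> j))\<^sup>2))" if "N \<le> M" for N M \<xi>
  proof -
    \<comment> \<open>The difference is the image of the block of \<open>\<xi>\<close> between
      \<open>N\<close> and \<open>M\<close>, to which \<open>norm_y\<close> applies.\<close>
    define \<zeta> where "\<zeta> = (\<lambda>j. if j < N then 0 else \<xi> j)"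
    have split: "(\<Sum>j<M. f j) = (\<Sum>j<N. f j) + (\<Sum>j<M. if j < N then 0 else f j)" for f :: "nat \<Rightarrow> 'b::ab_group_add"
    proof -
      have "(\<Sum>j<N. f j) = (\<Sum>j<M. if j < N then f j else 0)"
        using that by (intro sum.mono_neutral_cong_left) auto
      then show ?thesis by (simp add: sum.distrib[symmetric] cong: if_cong) (rule sum.cong, auto)
    qed
    have "y M \<xi> - y N \<xi> = y M \<zeta>"
    proof (rule ell2_eqI)
      fix i
      show "ell2_nth (y M \<xi> - y N \<xi>) i = ell2_nth (y M \<zeta>) i"
        unfolding minus_ell2.rep_eq nth_y split[of "\<lambda>j. blinfun_apply (w i j) (\<xi> j)"]
        by (simp add: \<zeta>_def if_distrib[of "blinfun_apply _"] cong: if_cong)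
    qed
    moreover have "(\<Sum>j<M. (norm (\<zeta> j))\<^sup>2) = (\<Sum>j<M. (norm (\<xi> j))\<^sup>2) - (\<Sum>j<N. (norm (\<xi> j))\<^sup>2)"
      unfolding split[of "\<lambda>j. (norm (\<xi> j))\<^sup>2"]
      by (simp add: \<zeta>_def if_distrib[of norm] if_distrib[of "\<lambda>x. x\<^sup>2"] cong: if_cong)
    ultimately show ?thesis using norm_y[of M \<zeta>] by (simp add: L2_set_def)
  qed
  define F where "F = (\<lambda>x. lim (\<lambda>N. y N (ell2_nth x)))"
  have conv: "(\<lambda>N. y N (ell2_nth x)) \<longlonglongrightarrow> F x" for x
  proof -
    define s where "s = (\<lambda>N. \<Sum>j<N. (norm (ell2_nth x j))\<^sup>2)"
    have s: "Cauchy s"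
      using summable_ell2_nth[of x] unfolding s_def summable_iff_convergent by (rule convergent_Cauchy)
    have "Cauchy (\<lambda>N. y N (ell2_nth x))"
    proof (rule CauchyI')
      fix e :: real assume e: "0 < e"
      \<comment> \<open>Dividing by \<open>C + 1\<close> instead of \<open>C\<close> keeps the
        choice valid for \<open>C = 0\<close>; the square compensates for the square root in
        \<open>diff_y\<close>.\<close>
      define d where "d = (e / (C + 1))\<^sup>2"
      have "d > 0" using e C by (simp add: d_def)
      then obtain M where M: "\<And>m n. m \<ge> M \<Longrightarrow> n \<ge> M \<Longrightarrow> norm (s m - s n) < d"
        using CauchyD[OF s] by blast
      have "dist (y m (ell2_nth x)) (y n (ell2_nth x)) < e" if "m \<ge> M" "n > m" for m n
      proof -
        have "s n - s m < d" using M[of n m] that by simp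
        then have "sqrt (s n - s m) < e / (C + 1)"
          using e C by (intro real_less_lsqrt) (auto simp: d_def)
        then have "(C + 1) * sqrt (s n - s m) < e" using C by (simp add: field_simps)
        moreover have "0 \<le> sqrt (s n - s m)"
          using that by (auto simp: s_def intro!: sum_mono2)
        ultimately have "C * sqrt (s n - s m) < e" unfolding distrib_right by linarith
        moreover have "norm (y n (ell2_nth x) - y m (ell2_nth x)) \<le> C * sqrt (s n - s m)"
          unfolding s_def using that by (intro diff_y) simp
        ultimately show ?thesis by (simp add: dist_norm norm_minus_commute)
      qed
      then show "\<exists>M. \<forall>m\<ge>M. \<forall>n>m. dist (y m (ell2_nth x)) (y n (ell2_nth x)) < e" by blast
    qed
    then show ?thesis
      unfolding F_def by (intro convergent_LIMSEQ_iff[THEN iffD1] Cauchy_convergent)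
  qed
  have "bounded_linear F"
  proof (rule bounded_linear_intro)
    fix x z and r :: real
    have "y N (ell2_nth (x + z)) = y N (ell2_nth x) + y N (ell2_nth z)" for N
      by (rule ell2_eqI) (simp add: nth_y plus_ell2.rep_eq blinfun.add_right sum.distrib)
    then have "(\<lambda>N. y N (ell2_nth (x + z))) \<longlonglongrightarrow> F x + F z"
      by (simp add: tendsto_add conv)
    then show "F (x + z) = F x + F z" using conv LIMSEQ_unique by blast
    have "y N (ell2_nth (r *\<^sub>R x)) = r *\<^sub>R y N (ell2_nth x)" for N
      by (rule ell2_eqI) (simp add: nth_y scaleR_ell2.rep_eq blinfun.scaleR_right scaleR_sum_right)
    then have "(\<lambda>N. y N (ell2_nth (r *\<^sub>R x))) \<longlonglongrightarrow> r *\<^sub>R F x"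
      by (simp add: tendsto_scaleR conv)
    then show "F (r *\<^sub>R x) = r *\<^sub>R F x" using conv LIMSEQ_unique by blast
    show "norm (F x) \<le> norm x * C"
    proof (rule tendsto_upperbound[OF tendsto_norm[OF conv]])
      have "norm (y N (ell2_nth x)) \<le> norm x * C" for N
        using order.trans[OF norm_y mult_left_mono[OF L2_set_le_norm_ell2 C]] by (simp add: mult.commute)
      then show "\<forall>\<^sub>F N in sequentially. norm (y N (ell2_nth x)) \<le> norm x * C" by simp
    qed simp
  qed
  then have F: "blinfun_apply (Blinfun F) x = F x" for x by (simp add: bounded_linear_Blinfun_apply)
  have nF: "norm (Blinfun F) \<le> C"
  proof (rule norm_blinfun_bound[OF C])
    show "norm (blinfun_apply (Blinfun F) x) \<le> C * norm x" for x
      unfolding F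
    proof (rule tendsto_upperbound[OF tendsto_norm[OF conv]])
      show "\<forall>\<^sub>F N in sequentially. norm (y N (ell2_nth x)) \<le> C * norm x"
        using order.trans[OF norm_y mult_left_mono[OF L2_set_le_norm_ell2 C]] by simp
    qed simp
  qed
  have "ell2_entry (Blinfun F) i j = w i j" for i j
  proof (rule blinfun_eqI)
    fix h
    have "(\<lambda>N. ell2_nth (y N (ell2_nth (ell2_single j h))) i) \<longlonglongrightarrow> ell2_nth (F (ell2_single j h)) i"
      by (intro bounded_linear.tendsto[OF bounded_linear_ell2_nth] conv)
    moreover have "(\<lambda>N. ell2_nth (y N (ell2_nth (ell2_single j h))) i) \<longlonglongrightarrow> blinfun_apply (w i j) h"
    proof (rule tendsto_eventually)
      show "\<forall>\<^sub>F N in sequentially. ell2_nth (y N (ell2_nth (ell2_single j h))) i = blinfun_apply (w i j) h"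
        using eventually_gt_at_top[of j]
        by eventually_elim (simp add: nth_y ell2_single.rep_eq if_distrib[of "blinfun_apply _"] cong: if_cong)
    qed
    ultimately show "blinfun_apply (ell2_entry (Blinfun F) i j) h = blinfun_apply (w i j) h"
      unfolding ell2_entry_apply F by (rule LIMSEQ_unique)
  qed
  then show ?thesis using that nF by blast
qed


subsection \<open>Amplifications and the approximation property\<close>

lemma bounded_ops_scaleC: "u \<in> bounded_ops \<Longrightarrow> blinfun_apply u (a *\<^sub>C x) = a *\<^sub>C blinfun_apply u x"
  by (simp add: bounded_ops_def clinear_on_def)

text \<open>Multiplication by a complex scalar commutes with every entry and with the convergent
  series for the coordinates.\<close>

lemma bounded_ops_ell2I:
  fixes u :: "'h::chilbert_space ell2 \<Rightarrow>\<^sub>L 'h ell2"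
  assumes "\<And>i j. ell2_entry u i j \<in> bounded_ops"
  shows "u \<in> bounded_ops"
proof -
  have "blinfun_apply u (a *\<^sub>C x) = a *\<^sub>C blinfun_apply u x" for a x
  proof (rule ell2_eqI)
    fix i
    have "(\<lambda>j. blinfun_apply (ell2_entry u i j) (ell2_nth (a *\<^sub>C x) j)) sums (a *\<^sub>C ell2_nth (blinfun_apply u x) i)"
      using bounded_linear.sums[OF bounded_linear_scaleC_right sums_ell2_entry[of u i x], of a]
      by (simp add: scaleC_ell2.rep_eq bounded_ops_scaleC[OF assms])
    then show "ell2_nth (blinfun_apply u (a *\<^sub>C x)) i = ell2_nth (a *\<^sub>C blinfun_apply u x) i"
      using sums_unique2[OF sums_ell2_entry[of u i "a *\<^sub>C x"]] by (simp add: scaleC_ell2.rep_eq)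
  qed
  then show ?thesis by (simp add: bounded_ops_def clinear_on_def blinfun.add_right)
qed

lemma bounded_linear_scaleC_left: "bounded_linear (\<lambda>a. a *\<^sub>C (x::'a::complex_normed_vector))"
proof (rule bounded_linear_intro[where K="norm x"])
  show "(r *\<^sub>R a) *\<^sub>C x = r *\<^sub>R a *\<^sub>C x" for r a
    by (simp only: scaleR_scaleC scaleC_scaleC scaleC_complex_def)
qed (simp_all add: scaleC_add_left norm_scaleC)

lemma tensor_vec_single: "tensor_vec (ell2_single j 1) h = ell2_single j h"
  by (rule ell2_eqI) (simp add: tensor_vec.rep_eq ell2_single.rep_eq)

text \<open>The operator is assembled from the matrix whose entries are the scalar entries of
  \<open>k\<close> times \<open>v\<close>; amplifying the scalar matrix to \<open>H\<close> gives
  the product bound. Existence is one half of what the definite description in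
  \<open>op_tensor\<close> requires.\<close>

lemma op_tensor_exists:
  fixes v :: "'h::chilbert_space \<Rightarrow>\<^sub>L 'h"
  assumes k: "k \<in> bounded_ops" and v: "v \<in> bounded_ops"
  obtains S where "S \<in> bounded_ops" "norm S \<le> norm k * norm v"
    "\<And>\<xi> h. blinfun_apply S (tensor_vec \<xi> h) = tensor_vec (blinfun_apply k \<xi>) (blinfun_apply v h)"
proof -
  \<comment> \<open>A complex linear operator on \<open>complex\<close> is multiplication by its
    value at 1, so these numbers are the matrix of \<open>k\<close>.\<close>
  define a where "a = (\<lambda>i j. blinfun_apply (ell2_entry k i j) 1)"
  have a: "blinfun_apply (ell2_entry k i j) c = a i j * c" for i j c
  proof -
    have "ell2_single j c = c *\<^sub>C ell2_single j 1"
      by (rule ell2_eqI) (simp add: ell2_single.rep_eq scaleC_ell2.rep_eq scaleC_complex_def)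
    then show ?thesis
      by (simp add: a_def ell2_entry_apply bounded_ops_scaleC[OF k] scaleC_ell2.rep_eq scaleC_complex_def)
  qed
  obtain S where S: "\<And>i j. ell2_entry S i j = a i j *\<^sub>C v" "norm S \<le> norm k * norm v"
  proof (rule ell2_operator_of_matrix)
    fix n and \<xi> :: "nat \<Rightarrow> 'h"
    have "L2_set (\<lambda>i. norm (\<Sum>j<n. a i j *\<^sub>C blinfun_apply v (\<xi> j))) {..<n}
        \<le> norm k * L2_set (\<lambda>j. norm (blinfun_apply v (\<xi> j))) {..<n}"
      by (rule scalar_matrix_amplification) (use ell2_entry_matrix_bound[of k] in \<open>simp_all add: a\<close>)
    also have "\<dots> \<le> norm k * (norm v * L2_set (\<lambda>j. norm (\<xi> j)) {..<n})"
      by (intro mult_left_mono L2_set_blinfun_le) simp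
    finally show "L2_set (\<lambda>i. norm (\<Sum>j<n. blinfun_apply (a i j *\<^sub>C v) (\<xi> j))) {..<n}
      \<le> norm k * norm v * L2_set (\<lambda>j. norm (\<xi> j)) {..<n}"
      by (simp add: scaleC_blinfun.rep_eq)
  qed auto
  show ?thesis
  proof (rule that[OF _ S(2)])
    show "S \<in> bounded_ops"
      by (rule bounded_ops_ell2I)
        (simp add: S bounded_ops_def clinear_on_def scaleC_blinfun.rep_eq blinfun.add_right
          bounded_ops_scaleC[OF v] scaleC_add_right scaleC_scaleC mult.commute)
    fix \<xi> h
    show "blinfun_apply S (tensor_vec \<xi> h) = tensor_vec (blinfun_apply k \<xi>) (blinfun_apply v h)"
    proof (rule ell2_eqI)
      fix i
      have "(\<lambda>j. blinfun_apply (ell2_entry S i j) (ell2_nth (tensor_vec \<xi> h) j))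
          sums (ell2_nth (blinfun_apply k \<xi>) i *\<^sub>C blinfun_apply v h)"
        using bounded_linear.sums[OF bounded_linear_scaleC_left sums_ell2_entry[of k i \<xi>], of "blinfun_apply v h"]
        by (simp add: S a tensor_vec.rep_eq scaleC_blinfun.rep_eq bounded_ops_scaleC[OF v] scaleC_scaleC)
      then show "ell2_nth (blinfun_apply S (tensor_vec \<xi> h)) i = ell2_nth (tensor_vec (blinfun_apply k \<xi>) (blinfun_apply v h)) i"
        using sums_unique2[OF sums_ell2_entry[of S i "tensor_vec \<xi> h"]] by (simp add: tensor_vec.rep_eq)
    qed
  qed
qed

text \<open>The defining condition on elementary tensors with unit vectors of the sequence space
  already fixes every matrix entry. This gives the uniqueness that the definite description still
  needs, and the entries themselves.\<close>

lemma
  fixes v :: "'h::chilbert_space \<Rightarrow>\<^sub>L 'h"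
  assumes k: "k \<in> bounded_ops" and v: "v \<in> bounded_ops"
  shows norm_op_tensor_le: "norm (op_tensor k v) \<le> norm k * norm v"
    and ell2_entry_op_tensor: "ell2_entry (op_tensor k v) i j = blinfun_apply (ell2_entry k i j) 1 *\<^sub>C v"
proof -
  have entry: "ell2_entry S i j = blinfun_apply (ell2_entry k i j) 1 *\<^sub>C v"
    if "\<forall>\<xi> h. blinfun_apply S (tensor_vec \<xi> h) = tensor_vec (blinfun_apply k \<xi>) (blinfun_apply v h)" for S i j
    by (rule blinfun_eqI, subst ell2_entry_apply, subst tensor_vec_single[symmetric])
      (simp add: ell2_entry_apply scaleC_blinfun.rep_eq that tensor_vec.rep_eq)
  obtain S where S: "S \<in> bounded_ops" "norm S \<le> norm k * norm v"
    "\<forall>\<xi> h. blinfun_apply S (tensor_vec \<xi> h) = tensor_vec (blinfun_apply k \<xi>) (blinfun_apply v h)"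
    using op_tensor_exists[OF k v] by metis
  have "op_tensor k v = S"
    unfolding op_tensor_def
    by (rule the_equality) (use S in \<open>auto intro!: ell2_entry_eqI simp: entry\<close>)
  with S entry[OF S(3)] show "norm (op_tensor k v) \<le> norm k * norm v"
    "ell2_entry (op_tensor k v) i j = blinfun_apply (ell2_entry k i j) 1 *\<^sub>C v" by auto
qed

lemma csubspace_closure:
  fixes S :: "'a::complex_normed_vector set"
  assumes S: "csubspace S"
  shows "csubspace (closure S)"
proof (rule complex_vector.subspaceI)
  show "0 \<in> closure S" using complex_vector.subspace_0[OF S] closure_subset by blast
next
  fix x y assume "x \<in> closure S" "y \<in> closure S"
  then obtain f g where "\<And>n. f n \<in> S" "f \<longlonglongrightarrow> x" "\<And>n. g n \<in> S" "g \<longlonglongrightarrow> y"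
    unfolding closure_sequential by blast
  then show "x + y \<in> closure S"
    unfolding closure_sequential
    by (intro exI[of _ "\<lambda>n. f n + g n"]) (auto intro: tendsto_add complex_vector.subspace_add[OF S])
next
  fix c x assume "x \<in> closure S"
  then obtain f where "\<And>n. f n \<in> S" "f \<longlonglongrightarrow> x"
    unfolding closure_sequential by blast
  then show "c *\<^sub>C x \<in> closure S"
    unfolding closure_sequential
    by (intro exI[of _ "\<lambda>n. c *\<^sub>C f n"])
      (auto intro: bounded_linear.tendsto[OF bounded_linear_scaleC_right] complex_vector.subspace_scale[OF S])
qed

lemma clinear_on_cspan_eqI:
  assumes C: "csubspace C" and G: "G \<subseteq> C" and "clinear_on C \<Phi>" "clinear_on C \<Psi>"
    and eq: "\<And>x. x \<in> G \<Longrightarrow> \<Phi> x = \<Psi> x" and x: "x \<in> cspan G"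
  shows "\<Phi> x = \<Psi> x"
proof -
  \<comment> \<open>Membership in \<open>C\<close> is carried through the induction because both
    maps are linear on \<open>C\<close> only.\<close>
  from x have "x \<in> C \<and> \<Phi> x = \<Psi> x"
  proof (induction rule: complex_vector.span_induct_alt)
    case base
    show ?case using clinear_on_0[OF C] complex_vector.subspace_0[OF C] assms by metis
  next
    case (step c x y)
    then have "x \<in> C" "c *\<^sub>C x \<in> C" "y \<in> C"
      using G complex_vector.subspace_scale[OF C, of x c] by auto
    then show ?case
      using step eq[OF step(1)] assms(3,4)
      by (simp add: clinear_on_add clinear_on_scaleC complex_vector.subspace_add[OF C])
  qed
  then show ?thesis ..
qed

lemma bounded_clinear_on_tendsto:
  assumes C: "csubspace C" and \<Phi>: "bounded_clinear_on C \<Phi>"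
    and f: "\<And>n. f n \<in> C" "x \<in> C" "f \<longlonglongrightarrow> x"
  shows "(\<lambda>n. \<Phi> (f n)) \<longlonglongrightarrow> \<Phi> x"
proof -
  obtain c where c: "\<And>x. x \<in> C \<Longrightarrow> norm (\<Phi> x) \<le> c * norm x" and lin: "clinear_on C \<Phi>"
    using \<Phi> unfolding bounded_clinear_on_def by blast
  have "(\<lambda>n. \<Phi> (f n) - \<Phi> x) \<longlonglongrightarrow> 0"
  proof (rule Lim_null_comparison)
    show "\<forall>\<^sub>F n in sequentially. norm (\<Phi> (f n) - \<Phi> x) \<le> c * norm (f n - x)"
      using c[OF complex_vector.subspace_diff[OF C f(1,2)]] clinear_on_diff[OF C lin f(1,2)] by simp
    show "(\<lambda>n. c * norm (f n - x)) \<longlonglongrightarrow> 0"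
      using f(3) by (intro tendsto_mult_right_zero tendsto_norm_zero LIM_zero)
  qed
  then show ?thesis by (rule LIM_zero_cancel)
qed

lemma compact_ops_bounded: "k \<in> compact_ops \<Longrightarrow> k \<in> bounded_ops"
  by (simp add: compact_ops_def)

text \<open>Operators with all entries in \<open>V\<close> form a closed complex subspace containing
  every generator \<open>op_tensor k v\<close>. Therefore a map given on \<open>V\<close> may be
  applied to each entry.\<close>

lemma ell2_entry_compact_tensor_min:
  assumes V: "operator_space V" and u: "u \<in> compact_tensor_min V"
  shows "ell2_entry u i j \<in> V"
proof -
  have sub: "csubspace V" "closed V" "V \<subseteq> bounded_ops"
    using V by (auto simp: operator_space_def)
  define M where "M = {u. \<forall>i j. ell2_entry u i j \<in> V}"
  have "csubspace M"
    unfolding M_def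
    by (rule complex_vector.subspaceI)
      (auto simp: ell2_entry_add ell2_entry_scaleC complex_vector.subspace_add[OF sub(1)]
        complex_vector.subspace_scale[OF sub(1)] complex_vector.subspace_0[OF sub(1)]
        linear_0[OF bounded_linear.linear[OF bounded_linear_ell2_entry]])
  moreover have "closed M"
  proof -
    have "closed ((\<lambda>u. ell2_entry u i j) -` V)" for i j
      using sub(2) by (intro continuous_closed_vimage linear_continuous_at bounded_linear_ell2_entry)
    then have "closed (\<Inter>i. \<Inter>j. (\<lambda>u. ell2_entry u i j) -` V)" by blast
    also have "(\<Inter>i. \<Inter>j. (\<lambda>u. ell2_entry u i j) -` V) = M" by (auto simp: M_def)
    finally show ?thesis .
  qed
  moreover have "{op_tensor k v |k v. k \<in> compact_ops \<and> v \<in> V} \<subseteq> M"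
  proof clarify
    fix k :: "complex ell2 \<Rightarrow>\<^sub>L complex ell2" and v assume "k \<in> compact_ops" "v \<in> V"
    then have "k \<in> bounded_ops" "v \<in> bounded_ops" using sub(3) by (auto simp: compact_ops_bounded)
    then show "op_tensor k v \<in> M"
      using \<open>v \<in> V\<close> by (simp add: M_def ell2_entry_op_tensor complex_vector.subspace_scale[OF sub(1)])
  qed
  ultimately have "compact_tensor_min V \<subseteq> M"
    unfolding compact_tensor_min_def by (intro closure_minimal complex_vector.span_minimal)
  then show ?thesis using u by (auto simp: M_def)
qed

lemma csubspace_compact_tensor_min: "csubspace (compact_tensor_min V)"
  unfolding compact_tensor_min_def by (intro csubspace_closure complex_vector.subspace_span)

text \<open>
  The amplification applies \<open>T\<close> to each entry of the operator matrix; its truncations are controlled by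
  the cb-norm of \<open>T\<close>.
\<close>

lemma amplification_exists:
  assumes V: "operator_space V" and T: "T ` V \<subseteq> V" "clinear_on V T" and c: "0 \<le> c" "cb_bounded_by V T c"
  obtains \<Phi> where "clinear_on (compact_tensor_min V) \<Phi>"
    "\<And>u. u \<in> compact_tensor_min V \<Longrightarrow> norm (\<Phi> u) \<le> c * norm u"
    "\<And>k v. k \<in> compact_ops \<Longrightarrow> v \<in> V \<Longrightarrow> \<Phi> (op_tensor k v) = op_tensor k (T v)"
proof -
  have sub: "csubspace V" "V \<subseteq> bounded_ops"
    using V by (auto simp: operator_space_def)
  have "\<exists>w. (\<forall>i j. ell2_entry w i j = T (ell2_entry u i j)) \<and> norm w \<le> c * norm u"
    if u: "u \<in> compact_tensor_min V" for u
  proof -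
    have "L2_set (\<lambda>i. norm (\<Sum>j<n. blinfun_apply (T (ell2_entry u i j)) (\<xi> j))) {..<n}
        \<le> c * norm u * L2_set (\<lambda>j. norm (\<xi> j)) {..<n}" for n \<xi>
    proof -
      have "matrix_norm n (\<lambda>i j. T (ell2_entry u i j)) \<le> c * matrix_norm n (ell2_entry u)"
        by (rule cb_bounded_byD[OF c(2)]) (rule ell2_entry_compact_tensor_min[OF V u])
      also have "matrix_norm n (ell2_entry u) \<le> norm u"
        by (rule matrix_norm_le) (simp_all add: ell2_entry_matrix_bound)
      finally have "matrix_norm n (\<lambda>i j. T (ell2_entry u i j)) \<le> c * norm u"
        using c(1) by (simp add: mult_left_mono)
      then show ?thesis
        by (intro order.trans[OF matrix_norm_apply] mult_right_mono) (simp_all add: L2_set_nonneg)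
    qed
    from ell2_operator_of_matrix[OF _ this] c(1) show ?thesis
      by (metis mult_nonneg_nonneg norm_ge_zero)
  qed
  then obtain \<Phi> where \<Phi>: "\<And>u i j. u \<in> compact_tensor_min V \<Longrightarrow> ell2_entry (\<Phi> u) i j = T (ell2_entry u i j)"
    "\<And>u. u \<in> compact_tensor_min V \<Longrightarrow> norm (\<Phi> u) \<le> c * norm u"
    by metis
  note E = ell2_entry_compact_tensor_min[OF V]
  note C = csubspace_compact_tensor_min[of V]
  have "clinear_on (compact_tensor_min V) \<Phi>"
    unfolding clinear_on_def
  proof (intro conjI ballI allI)
    fix x y assume xy: "x \<in> compact_tensor_min V" "y \<in> compact_tensor_min V"
    show "\<Phi> (x + y) = \<Phi> x + \<Phi> y"
      using xy by (intro ell2_entry_eqI)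
        (simp add: \<Phi> ell2_entry_add complex_vector.subspace_add[OF C] clinear_on_add[OF T(2)] E)
    show "\<Phi> (a *\<^sub>C x) = a *\<^sub>C \<Phi> x" for a
      using xy by (intro ell2_entry_eqI)
        (simp add: \<Phi> ell2_entry_scaleC complex_vector.subspace_scale[OF C] clinear_on_scaleC[OF T(2)] E)
  qed
  moreover have "\<Phi> (op_tensor k v) = op_tensor k (T v)" if kv: "k \<in> compact_ops" "v \<in> V" for k v
  proof (rule ell2_entry_eqI)
    have "op_tensor k v \<in> compact_tensor_min V"
      unfolding compact_tensor_min_def using kv
      by (intro subsetD[OF closure_subset] complex_vector.span_base) blast
    moreover have "k \<in> bounded_ops" "v \<in> bounded_ops" "T v \<in> bounded_ops"
      using kv sub(2) T(1) by (auto simp: compact_ops_bounded)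
    ultimately show "ell2_entry (\<Phi> (op_tensor k v)) i j = ell2_entry (op_tensor k (T v)) i j" for i j
      using kv by (simp add: \<Phi> ell2_entry_op_tensor clinear_on_scaleC[OF T(2)])
  qed
  ultimately show ?thesis using that \<Phi>(2) by blast
qed

text \<open>\<open>id_tensor\<close> is chosen by \<open>SOME\<close>, which promises a bounded map
  but no particular constant. Any admissible choice agrees with the entrywise amplification on the
  generators, hence on their span and by continuity on its closure; the bound \<open>c\<close> is
  inherited from there.\<close>

lemma
  assumes V: "operator_space V" and T: "T ` V \<subseteq> V" "clinear_on V T" and c: "0 \<le> c" "cb_bounded_by V T c"
  shows clinear_on_id_tensor: "clinear_on (compact_tensor_min V) (id_tensor V T)"
    and id_tensor_op_tensor: "\<And>k v. k \<in> compact_ops \<Longrightarrow> v \<in> V \<Longrightarrow> id_tensor V T (op_tensor k v) = op_tensor k (T v)"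
    and norm_id_tensor_le: "\<And>u. u \<in> compact_tensor_min V \<Longrightarrow> norm (id_tensor V T u) \<le> c * norm u"
proof -
  obtain \<Phi> where \<Phi>: "clinear_on (compact_tensor_min V) \<Phi>"
    "\<And>u. u \<in> compact_tensor_min V \<Longrightarrow> norm (\<Phi> u) \<le> c * norm u"
    "\<And>k v. k \<in> compact_ops \<Longrightarrow> v \<in> V \<Longrightarrow> \<Phi> (op_tensor k v) = op_tensor k (T v)"
    by (rule amplification_exists[OF assms]) (rule that)
  then have b\<Phi>: "bounded_clinear_on (compact_tensor_min V) \<Phi>"
    unfolding bounded_clinear_on_def by blast
  have some: "bounded_clinear_on (compact_tensor_min V) (id_tensor V T) \<and>
      (\<forall>k\<in>compact_ops. \<forall>v\<in>V. id_tensor V T (op_tensor k v) = op_tensor k (T v))"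
    unfolding id_tensor_def by (rule someI[of _ \<Phi>]) (use b\<Phi> \<Phi>(3) in blast)
  then show lin: "clinear_on (compact_tensor_min V) (id_tensor V T)"
    and gen: "\<And>k v. k \<in> compact_ops \<Longrightarrow> v \<in> V \<Longrightarrow> id_tensor V T (op_tensor k v) = op_tensor k (T v)"
    by (auto simp: bounded_clinear_on_def)
  fix u assume u: "u \<in> compact_tensor_min V"
  define G where "G = {op_tensor k v |k v. k \<in> compact_ops \<and> v \<in> V}"
  have GC: "cspan G \<subseteq> compact_tensor_min V"
    unfolding compact_tensor_min_def G_def by (rule closure_subset)
  obtain f where f: "\<And>n. f n \<in> cspan G" "f \<longlonglongrightarrow> u"
    using u unfolding compact_tensor_min_def G_def[symmetric] closure_sequential by blast
  have "id_tensor V T (f n) = \<Phi> (f n)" for n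
  proof (rule clinear_on_cspan_eqI[OF csubspace_compact_tensor_min _ lin \<Phi>(1) _ f(1)])
    show "G \<subseteq> compact_tensor_min V" using GC complex_vector.span_superset by blast
  qed (auto simp: G_def gen \<Phi>(3))
  moreover have fC: "f n \<in> compact_tensor_min V" for n using f(1) GC by blast
  note lim = bounded_clinear_on_tendsto[OF csubspace_compact_tensor_min _ fC u f(2)]
  have "(\<lambda>n. id_tensor V T (f n)) \<longlonglongrightarrow> id_tensor V T u"
    using some by (intro lim) (rule conjunct1)
  ultimately have "id_tensor V T u = \<Phi> u"
    using lim[OF b\<Phi>] by (simp add: LIMSEQ_unique)
  then show "norm (id_tensor V T u) \<le> c * norm u" using \<Phi>(2)[OF u] by simp
qed

lemma op_tensor_diff_right:
  assumes "k \<in> bounded_ops" "v \<in> bounded_ops" "w \<in> bounded_ops" "v - w \<in> bounded_ops"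
  shows "op_tensor k v - op_tensor k w = op_tensor k (v - w)"
proof -
  have "op_tensor k v = op_tensor k (v - w) + op_tensor k w"
    using assms by (intro ell2_entry_eqI)
      (simp add: ell2_entry_add ell2_entry_op_tensor flip: scaleC_add_right)
  then show ?thesis by simp
qed

text \<open>Uniformly bounded amplifications that converge on the dense span of the elementary
  tensors converge everywhere. On an elementary tensor the convergence is that of
  \<open>q k v\<close> to \<open>v\<close>.\<close>

lemma OAP_if_cb_approximation:
  assumes V: "operator_space V"
    and q: "\<And>k. q k ` V \<subseteq> V" "\<And>k. clinear_on V (q k)" "\<And>k. cfinite_dim (q k ` V)"
      "\<And>k. cb_bounded_by V (q k) c" and c: "0 \<le> c"
    and lim: "\<And>v. v \<in> V \<Longrightarrow> (\<lambda>k. q k v) \<longlonglongrightarrow> v"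
  shows "OAP V"
  unfolding OAP_def
proof (intro ballI allI impI)
  fix u and \<epsilon> :: real assume u: "u \<in> compact_tensor_min V" and \<epsilon>: "0 < \<epsilon>"
  have sub: "csubspace V" "V \<subseteq> bounded_ops"
    using V by (auto simp: operator_space_def)
  note C = csubspace_compact_tensor_min[of V]
  define \<Phi> where "\<Phi> = (\<lambda>k. id_tensor V (q k))"
  have lin: "clinear_on (compact_tensor_min V) (\<Phi> k)" for k
    unfolding \<Phi>_def by (rule clinear_on_id_tensor[OF V q(1,2) c q(4)])
  have gen: "\<Phi> k (op_tensor a v) = op_tensor a (q k v)" if "a \<in> compact_ops" "v \<in> V" for k a v
    unfolding \<Phi>_def by (rule id_tensor_op_tensor[OF V q(1,2) c q(4) that])
  have bnd: "norm (\<Phi> k u) \<le> c * norm u" if "u \<in> compact_tensor_min V" for k u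
    unfolding \<Phi>_def by (rule norm_id_tensor_le[OF V q(1,2) c q(4) that])
  define G where "G = {op_tensor k v |k v. k \<in> compact_ops \<and> v \<in> V}"
  have GC: "cspan G \<subseteq> compact_tensor_min V"
    unfolding compact_tensor_min_def G_def by (rule closure_subset)
  \<comment> \<open>Membership is proved along with the convergence, since linearity of
    \<open>\<Phi> k\<close> is available on \<open>compact_tensor_min V\<close> only.\<close>
  have lim_span: "w \<in> compact_tensor_min V \<and> (\<lambda>k. \<Phi> k w) \<longlonglongrightarrow> w" if "w \<in> cspan G" for w
    using that
  proof (induction rule: complex_vector.span_induct_alt)
    case base
    then show ?case by (simp add: clinear_on_0[OF C lin] complex_vector.subspace_0[OF C])
  next
    case (step b x y)
    from step(1) obtain a v where x: "x = op_tensor a v" "a \<in> compact_ops" "v \<in> V"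
      unfolding G_def by blast
    have "(\<lambda>k. op_tensor a (q k v) - op_tensor a v) \<longlonglongrightarrow> 0"
    proof (rule Lim_null_comparison)
      have "norm (op_tensor a (q k v) - op_tensor a v) \<le> norm a * norm (q k v - v)" for k
      proof -
        have qv: "q k v \<in> V" using q(1) x(3) by blast
        then have "q k v - v \<in> V" using x(3) by (rule complex_vector.subspace_diff[OF sub(1)])
        then show ?thesis
          using qv x sub(2) by (subst op_tensor_diff_right) (auto simp: compact_ops_bounded intro!: norm_op_tensor_le)
      qed
      then show "\<forall>\<^sub>F k in sequentially. norm (op_tensor a (q k v) - op_tensor a v) \<le> norm a * norm (q k v - v)"
        by simp
      show "(\<lambda>k. norm a * norm (q k v - v)) \<longlonglongrightarrow> 0"
        by (intro tendsto_mult_right_zero tendsto_norm_zero LIM_zero lim x)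
    qed
    then have "(\<lambda>k. \<Phi> k x) \<longlonglongrightarrow> x"
      using x by (simp add: gen LIM_zero_cancel)
    then have "(\<lambda>k. b *\<^sub>C \<Phi> k x + \<Phi> k y) \<longlonglongrightarrow> b *\<^sub>C x + y"
      by (intro tendsto_add bounded_linear.tendsto[OF bounded_linear_scaleC_right] conjunct2[OF step(2)])
    moreover have "x \<in> compact_tensor_min V" "y \<in> compact_tensor_min V"
      using step GC complex_vector.span_base[of x G] by auto
    ultimately show ?case
      by (simp add: clinear_on_add[OF lin] clinear_on_scaleC[OF lin] complex_vector.subspace_scale[OF C]
          complex_vector.subspace_add[OF C])
  qed
  \<comment> \<open>Replacing \<open>u\<close> by \<open>w\<close> costs \<open>c * \<delta>\<close>
    under \<open>\<Phi> k\<close> and \<open>\<delta>\<close> in the identity term, together half of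
    \<open>\<epsilon>\<close>.\<close>
  define \<delta> where "\<delta> = \<epsilon> / (2 * (c + 1))"
  have \<delta>: "\<delta> > 0" "(c + 1) * \<delta> = \<epsilon> / 2" using \<epsilon> c by (simp_all add: \<delta>_def field_simps)
  obtain w where w: "w \<in> cspan G" "norm (u - w) < \<delta>"
    using u \<delta>(1) unfolding compact_tensor_min_def G_def[symmetric] closure_approachable
    by (metis dist_norm norm_minus_commute)
  obtain k where k: "norm (\<Phi> k w - w) < \<epsilon> / 2"
    using LIMSEQ_D[OF conjunct2[OF lim_span[OF w(1)]], of "\<epsilon> / 2"] \<epsilon> by auto
  have wC: "w \<in> compact_tensor_min V" using w GC by blast
  have "norm (\<Phi> k u - u) = norm (\<Phi> k (u - w) + (\<Phi> k w - w) + (w - u))"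
    by (simp add: clinear_on_diff[OF C lin u wC])
  also have "\<dots> \<le> norm (\<Phi> k (u - w)) + norm (\<Phi> k w - w) + norm (w - u)"
    by (meson add_right_mono norm_triangle_ineq order.trans)
  also have "\<dots> < c * \<delta> + \<epsilon> / 2 + \<delta>"
  proof -
    have "norm (\<Phi> k (u - w)) \<le> c * norm (u - w)"
      by (intro bnd complex_vector.subspace_diff[OF C] u wC)
    also have "\<dots> \<le> c * \<delta>" using w(2) c by (intro mult_left_mono) auto
    finally show ?thesis using k w(2) by (simp add: norm_minus_commute)
  qed
  also have "\<dots> = \<epsilon>" using \<delta>(2) by (simp add: distrib_right)
  finally have "norm (id_tensor V (q k) u - u) < \<epsilon>" by (simp add: \<Phi>_def)
  moreover have "completely_bounded V (q k)"
    unfolding completely_bounded_def using q(2) cb_bounded_by_imp_cb_norm[OF c q(4)] by blast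
  ultimately show "\<exists>T. T ` V \<subseteq> V \<and> completely_bounded V T \<and> cfinite_dim (T ` V) \<and> norm (id_tensor V T u - u) < \<epsilon>"
    using q(1,3) by blast
qed


subsection \<open>The gliding hump\<close>

text \<open>An injective linear map preserves independence, and an infinite independent set does not
  fit into the span of a finite one. The lemma serves both the sequence space itself, with the
  identity for \<open>G\<close>, and the subspace that will have the OAP.\<close>

lemma not_cfinite_dim_if_orthonormal_image:
  fixes x :: "nat \<Rightarrow> 'a::chilbert_space" and G :: "'a \<Rightarrow> 'b::complex_vector"
  assumes x: "orthonormal_on UNIV x" and G: "clinear_on UNIV G" "inj G" and V: "range (\<lambda>j. G (x j)) \<subseteq> V"
  shows "\<not> cfinite_dim V"
proof
  assume "cfinite_dim V"
  then obtain B where B: "finite B" "V \<subseteq> cspan B" unfolding cfinite_dim_def by blast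
  interpret G: Vector_Spaces.linear scaleC scaleC G
    by unfold_locales
      (use G(1) in \<open>auto simp: clinear_on_def scaleC_add_right scaleC_add_left scaleC_scaleC\<close>)
  have ind: "\<not> complex_vector.dependent (G ` range x)"
    by (rule G.independent_injective_image[OF orthonormal_independent[OF x]])
      (use G(2) in \<open>auto simp: inj_on_def\<close>)
  have "infinite (G ` range x)"
    using G(2) orthonormal_inj[OF x] by (metis finite_imageD infinite_UNIV_nat inj_on_subset subset_UNIV)
  moreover have "G ` range x \<subseteq> cspan B" using V B(2) by auto
  ultimately show False
    using complex_vector.independent_span_bound[OF B(1) ind] by blast
qed

lemma orthonormal_ell2_single: "orthonormal_on UNIV (\<lambda>j. ell2_single j (1::complex))"
proof -
  have "cinner (ell2_single i (1::complex)) (ell2_single j 1) = of_bool (i = j)" for i j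
    unfolding cinner_ell2_def ell2_single.rep_eq cinner_complex_def
    by (subst suminf_finite[of "{i}"]) auto
  then show ?thesis by (simp add: orthonormal_on_def)
qed

lemma not_cfinite_dim_ell2: "\<not> cfinite_dim (UNIV :: complex ell2 set)"
  by (rule not_cfinite_dim_if_orthonormal_image[OF orthonormal_ell2_single, where G="\<lambda>x. x"])
    (auto simp: clinear_on_def)

section \<open>Common kernels of finitely many functionals\<close>

lemma not_cfinite_dim_kernel:
  fixes \<phi> :: "'a::complex_vector \<Rightarrow> complex"
  assumes W: "csubspace W" "\<not> cfinite_dim W" and \<phi>: "clinear_on W \<phi>"
  shows "csubspace {w \<in> W. \<phi> w = 0} \<and> \<not> cfinite_dim {w \<in> W. \<phi> w = 0}"
proof
  show "csubspace {w \<in> W. \<phi> w = 0}"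
    by (rule complex_vector.subspaceI)
      (auto simp: clinear_on_0[OF W(1) \<phi>] clinear_on_add[OF \<phi>] clinear_on_scaleC[OF \<phi>]
        complex_vector.subspace_0[OF W(1)] complex_vector.subspace_add[OF W(1)]
        complex_vector.subspace_scale[OF W(1)] scaleC_complex_def)
  show "\<not> cfinite_dim {w \<in> W. \<phi> w = 0}"
  proof
    assume "cfinite_dim {w \<in> W. \<phi> w = 0}"
    then obtain B where B: "finite B" "{w \<in> W. \<phi> w = 0} \<subseteq> cspan B" unfolding cfinite_dim_def by blast
    have "\<exists>w\<in>W. \<phi> w \<noteq> 0"
    proof (rule ccontr)
      assume "\<not> ?thesis"
      then have "W \<subseteq> cspan B" using B(2) by blast
      then show False using W(2) B(1) unfolding cfinite_dim_def by blast
    qed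
    then obtain w where w: "w \<in> W" "\<phi> w \<noteq> 0" by blast
    \<comment> \<open>The kernel has codimension at most one: subtracting a multiple of
      \<open>w\<close> moves any \<open>x\<close> into it, so a finite spanning set of the kernel
      and \<open>w\<close> would span all of \<open>W\<close>.\<close>
    have "x \<in> cspan (insert w B)" if x: "x \<in> W" for x
    proof -
      define t where "t = \<phi> x / \<phi> w"
      have tw: "t *\<^sub>C w \<in> W" by (rule complex_vector.subspace_scale[OF W(1) w(1)])
      have "x - t *\<^sub>C w \<in> W" by (rule complex_vector.subspace_diff[OF W(1) x tw])
      moreover have "\<phi> (x - t *\<^sub>C w) = \<phi> x - t * \<phi> w"
        by (simp add: clinear_on_diff[OF W(1) \<phi> x tw] clinear_on_scaleC[OF \<phi> w(1)] scaleC_complex_def)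
      then have "\<phi> (x - t *\<^sub>C w) = 0"
        using w(2) by (simp add: t_def)
      ultimately have "x - t *\<^sub>C w \<in> cspan B" using B(2) by blast
      then have "x - t *\<^sub>C w \<in> cspan (insert w B)"
        using complex_vector.span_mono[of B "insert w B"] by blast
      moreover have "t *\<^sub>C w \<in> cspan (insert w B)"
        by (intro complex_vector.span_scale complex_vector.span_base) simp
      ultimately show ?thesis using complex_vector.span_add by fastforce
    qed
    then show False using W(2) B(1) unfolding cfinite_dim_def by (metis finite_insert subsetI)
  qed
qed

lemma not_cfinite_dim_common_kernel:
  fixes \<phi> :: "'i \<Rightarrow> 'a::complex_vector \<Rightarrow> complex"
  assumes "finite I" "\<And>i. i \<in> I \<Longrightarrow> clinear_on UNIV (\<phi> i)" "\<not> cfinite_dim (UNIV :: 'a set)"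
  shows "csubspace {w. \<forall>i\<in>I. \<phi> i w = 0} \<and> \<not> cfinite_dim {w. \<forall>i\<in>I. \<phi> i w = 0}"
  using assms(1,2)
proof (induction I)
  case empty
  then show ?case using assms(3) by simp
next
  case (insert i I)
  have "{w. \<forall>i\<in>insert i I. \<phi> i w = 0} = {w \<in> {w. \<forall>i\<in>I. \<phi> i w = 0}. \<phi> i w = 0}" by auto
  moreover have "clinear_on {w. \<forall>i\<in>I. \<phi> i w = 0} (\<phi> i)"
    by (rule clinear_on_subset[OF insert.prems]) simp_all
  ultimately show ?case
    using not_cfinite_dim_kernel[of "{w. \<forall>i\<in>I. \<phi> i w = 0}" "\<phi> i"] insert by simp
qed

lemma unit_vector_in_common_kernel:
  fixes \<phi> :: "'i \<Rightarrow> 'a::complex_normed_vector \<Rightarrow> complex"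
  assumes "finite I" "\<And>i. i \<in> I \<Longrightarrow> clinear_on UNIV (\<phi> i)" "\<not> cfinite_dim (UNIV :: 'a set)"
  obtains x where "norm x = 1" "\<And>i. i \<in> I \<Longrightarrow> \<phi> i x = 0"
proof -
  have "\<not> {w. \<forall>i\<in>I. \<phi> i w = 0} \<subseteq> {0}"
  proof
    assume "{w. \<forall>i\<in>I. \<phi> i w = 0} \<subseteq> {0}"
    then have "cfinite_dim {w. \<forall>i\<in>I. \<phi> i w = 0}"
      unfolding cfinite_dim_def by (intro exI[of _ "{}"]) simp
    then show False using not_cfinite_dim_common_kernel[of I \<phi>] assms by blast
  qed
  then obtain w where w: "w \<noteq> 0" "\<And>i. i \<in> I \<Longrightarrow> \<phi> i w = 0" by blast
  show ?thesis
  proof (rule that)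
    show "norm (complex_of_real (inverse (norm w)) *\<^sub>C w) = 1"
      using w(1) by (simp add: norm_scaleC norm_inverse)
    show "\<phi> i (complex_of_real (inverse (norm w)) *\<^sub>C w) = 0" if "i \<in> I" for i
      using w(2)[OF that] clinear_on_scaleC[OF assms(2)[OF that], of w] by (simp add: scaleC_complex_def)
  qed
qed

text \<open>\<open>R l\<close> involves only the functionals \<open>a n\<close> with
  \<open>n < l\<close>, so a vector on which the first \<open>N\<close> of them vanish is killed
  exactly by every \<open>R l\<close> with \<open>l \<le> N\<close>. Finitely many further
  functionals enforce orthogonality to the vectors chosen before.\<close>

lemma gliding_hump:
  fixes a :: "nat \<Rightarrow> 'h::chilbert_space \<Rightarrow> complex" and e :: "nat \<Rightarrow> 'b::complex_normed_vector"
  defines "R \<equiv> \<lambda>m x. \<Sum>n<m. a n x *\<^sub>C e n"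
  assumes a: "\<And>n. clinear_on UNIV (a n)" and lim: "\<And>x. (\<lambda>m. R m x) \<longlonglongrightarrow> D x"
    and inf: "\<not> cfinite_dim (UNIV :: 'h set)"
  obtains x m where "orthonormal_on UNIV x" "\<And>i k. i \<le> k \<Longrightarrow> R (m i) (x k) = 0"
    "\<And>j k. j < k \<Longrightarrow> norm (D (x j) - R (m k) (x j)) \<le> 1 / (real k + 1)"
proof -
  \<comment> \<open>\<open>P f k r\<close> says that the pair \<open>r\<close>, a vector with its
    index, may follow the pairs \<open>f j\<close> with \<open>j < k\<close>. The approximation
    condition concerns earlier vectors only, so the index is chosen before the vector, which can
    then be killed by its own index too.\<close>
  define P where "P = (\<lambda>(f :: nat \<Rightarrow> 'h \<times> nat) k r.
    norm (fst r) = 1 \<and> R (snd r) (fst r) = 0 \<and> (\<forall>j<k. cinner (fst (f j)) (fst r) = 0) \<and>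
    (\<forall>i<k. R (snd (f i)) (fst r) = 0) \<and>
    (\<forall>j<k. norm (D (fst (f j)) - R (snd r) (fst (f j))) \<le> 1 / (real k + 1)))"
  have "\<exists>f. \<forall>k. P f k (f k)"
  proof (rule dependent_wellorder_choice)
    show "P f k r = P g k r" if "\<And>y. y < k \<Longrightarrow> f y = g y" for r f g k
      using that by (simp add: P_def)
    fix k and f :: "nat \<Rightarrow> 'h \<times> nat"
    have "\<forall>\<^sub>F m in sequentially. \<forall>j\<in>{..<k}. norm (D (fst (f j)) - R m (fst (f j))) < 1 / (real k + 1)"
    proof (rule eventually_ball_finite)
      show "\<forall>j\<in>{..<k}. \<forall>\<^sub>F m in sequentially. norm (D (fst (f j)) - R m (fst (f j))) < 1 / (real k + 1)"
        using tendstoD[OF lim, of "1 / (real k + 1)"] by (simp add: dist_norm norm_minus_commute)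
    qed simp
    then obtain m where m: "\<And>j. j < k \<Longrightarrow> norm (D (fst (f j)) - R m (fst (f j))) < 1 / (real k + 1)"
      unfolding eventually_sequentially by auto
    \<comment> \<open>A bound for the new index and all previous ones, so that a single kernel
      condition handles them all.\<close>
    define N where "N = Max (insert m ((\<lambda>i. snd (f i)) ` {..<k}))"
    have N: "m \<le> N" "\<And>i. i < k \<Longrightarrow> snd (f i) \<le> N"
      unfolding N_def by (intro Max_ge; simp)+
    \<comment> \<open>The sum type merges the coefficient functionals (\<open>Inl\<close>) and the
      inner products with earlier vectors (\<open>Inr\<close>) into one family.\<close>
    define \<phi> where "\<phi> = case_sum a (\<lambda>j. cinner (fst (f j)))"
    obtain x where x: "norm x = 1" "\<And>i. i \<in> Inl ` {..<N} \<union> Inr ` {..<k} \<Longrightarrow> \<phi> i x = 0"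
    proof (rule unit_vector_in_common_kernel[of "Inl ` {..<N} \<union> Inr ` {..<k}" \<phi>])
      show "clinear_on UNIV (\<phi> i)" for i
        using a by (cases i)
          (simp_all add: \<phi>_def clinear_on_def cinner_add_right cinner_scaleC_right scaleC_complex_def)
    qed (use inf in auto)
    have 0: "R l x = 0" if "l \<le> N" for l
      unfolding R_def
    proof (intro sum.neutral ballI)
      fix n assume "n \<in> {..<l}"
      then show "a n x *\<^sub>C e n = 0" using x(2)[of "Inl n"] that by (simp add: \<phi>_def)
    qed
    have "cinner (fst (f j)) x = 0" if "j < k" for j
      using x(2)[of "Inr j"] that by (simp add: \<phi>_def)
    then show "\<exists>r. P f k r"
      using x(1) 0 N m by (intro exI[of _ "(x, m)"]) (auto simp: P_def intro: less_imp_le)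
  qed
  then obtain f where f: "\<And>k. P f k (f k)" by blast
  define x where "x = (\<lambda>k. fst (f k))"
  define m where "m = (\<lambda>k. snd (f k))"
  have orth: "cinner (x j) (x k) = 0" if "j < k" for j k
    using f[of k] that by (simp add: P_def x_def)
  show ?thesis
  proof (rule that)
    show "orthonormal_on UNIV x"
      unfolding orthonormal_on_def
    proof (intro ballI)
      fix i j
      have "cinner (x i) (x i) = 1" using f[of i] by (simp add: P_def x_def cinner_self)
      moreover have "cinner (x i) (x j) = 0" if "j < i"
        using orth[OF that] cinner_commute[of "x i" "x j"] by simp
      ultimately show "cinner (x i) (x j) = of_bool (i = j)"
        using orth[of i j] by (cases i j rule: linorder_cases) auto
    qed
    show "R (m i) (x k) = 0" if "i \<le> k" for i k
      using f[of k] that by (cases "i = k") (auto simp: P_def x_def m_def)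
    show "norm (D (x j) - R (m k) (x j)) \<le> 1 / (real k + 1)" if "j < k" for j k
      using f[of k] that by (auto simp: P_def x_def m_def)
  qed
qed

text \<open>\<open>W\<close> is the closed span of the \<open>x j\<close>, described by the
  convergence of orthonormal expansions, so that the convergence is at hand by definition.
  Closedness follows because all \<open>Q k\<close> are contractions.\<close>

lemma orthonormal_expansion_set:
  fixes x :: "nat \<Rightarrow> 'h::chilbert_space"
  assumes x: "orthonormal_on UNIV x"
  defines "Q \<equiv> \<lambda>k \<xi>. \<Sum>j<k. cinner (x j) \<xi> *\<^sub>C x j"
  defines "W \<equiv> {\<xi>. (\<lambda>k. Q k \<xi>) \<longlonglongrightarrow> \<xi>}"
  shows "csubspace W" "closed W" "\<And>j. x j \<in> W"
proof -
  have Q_add: "Q k (\<xi> + \<eta>) = Q k \<xi> + Q k \<eta>" for k \<xi> \<eta>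
    by (simp add: Q_def cinner_add_right scaleC_add_left sum.distrib)
  have Q_scale: "Q k (c *\<^sub>C \<xi>) = c *\<^sub>C Q k \<xi>" for k c \<xi>
    by (simp add: Q_def cinner_scaleC_right scaleC_scaleC complex_vector.scale_sum_right)
  have Q_diff: "Q k (\<xi> - \<eta>) = Q k \<xi> - Q k \<eta>" for k \<xi> \<eta>
    using Q_add[of k "\<xi> - \<eta>" \<eta>] by simp
  have Q_norm: "norm (Q k \<xi>) \<le> norm \<xi>" for k \<xi>
    unfolding Q_def by (rule norm_orthonormal_projection_le) (use x in \<open>auto simp: orthonormal_on_def\<close>)
  show "csubspace W"
  proof (rule complex_vector.subspaceI)
    show "0 \<in> W" using Q_scale[of _ 0 0] by (simp add: W_def)
    show "\<xi> + \<eta> \<in> W" if "\<xi> \<in> W" "\<eta> \<in> W" for \<xi> \<eta>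
      using that by (simp add: W_def Q_add tendsto_add)
    show "c *\<^sub>C \<xi> \<in> W" if "\<xi> \<in> W" for c \<xi>
      using that by (simp add: W_def Q_scale bounded_linear.tendsto[OF bounded_linear_scaleC_right])
  qed
  show "closed W"
    unfolding closed_limpt islimpt_approachable
  proof (intro allI impI)
    fix \<xi> assume \<xi>: "\<forall>e>0. \<exists>\<eta>\<in>W. \<eta> \<noteq> \<xi> \<and> dist \<eta> \<xi> < e"
    have "(\<lambda>k. Q k \<xi>) \<longlonglongrightarrow> \<xi>"
    proof (rule LIMSEQ_I)
      fix r :: real assume r: "0 < r"
      obtain \<eta> where \<eta>: "\<eta> \<in> W" "norm (\<xi> - \<eta>) < r / 3"
        using \<xi> r by (metis dist_norm norm_minus_commute zero_less_divide_iff zero_less_numeral)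
      obtain M where M: "\<And>k. k \<ge> M \<Longrightarrow> norm (Q k \<eta> - \<eta>) < r / 3"
        using \<eta>(1) r LIMSEQ_D[of "\<lambda>k. Q k \<eta>" \<eta> "r / 3"] by (auto simp: W_def)
      have "norm (Q k \<xi> - \<xi>) < r" if "k \<ge> M" for k
      proof -
        have "norm (Q k \<xi> - \<xi>) = norm (Q k (\<xi> - \<eta>) + (Q k \<eta> - \<eta>) + (\<eta> - \<xi>))"
          by (simp add: Q_diff)
        also have "\<dots> \<le> norm (Q k (\<xi> - \<eta>)) + norm (Q k \<eta> - \<eta>) + norm (\<eta> - \<xi>)"
          by (meson add_right_mono norm_triangle_ineq order.trans)
        also have "\<dots> < r / 3 + r / 3 + r / 3"
          using Q_norm[of k "\<xi> - \<eta>"] M[OF that] \<eta>(2) by (simp add: norm_minus_commute)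
        finally show ?thesis by simp
      qed
      then show "\<exists>M. \<forall>k\<ge>M. norm (Q k \<xi> - \<xi>) < r" by blast
    qed
    then show "\<xi> \<in> W" by (simp add: W_def)
  qed
  show "x j \<in> W" for j
  proof -
    have "Q k (x j) = x j" if "j < k" for k
    proof -
      have "Q k (x j) = (\<Sum>i<k. if i = j then x j else 0)"
        unfolding Q_def using x by (intro sum.cong) (auto simp: orthonormal_on_def)
      then show ?thesis using that by simp
    qed
    then have "(\<lambda>k. Q k (x j)) \<longlonglongrightarrow> x j"
      by (intro tendsto_eventually eventually_sequentiallyI[of "Suc j"]) simp
    then show ?thesis by (simp add: W_def)
  qed
qed


subsection \<open>Subspaces with the approximation property\<close>

lemma OAP_subspace_of_hilbertian:
  fixes X\<^sub>0 :: "('h::chilbert_space \<Rightarrow>\<^sub>L 'h) set" and Y :: "('k::chilbert_space \<Rightarrow>\<^sub>L 'k) set"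
  assumes X: "operator_space X\<^sub>0" "isometric_to_ell2 X\<^sub>0"
    and T: "clinear_on X\<^sub>0 T" "0 \<le> cT" "cb_bounded_by X\<^sub>0 T cT" "T ` X\<^sub>0 \<subseteq> Y"
    and U: "0 \<le> cU" "cb_bounded_by (T ` X\<^sub>0) U cU" "\<And>x. x \<in> X\<^sub>0 \<Longrightarrow> U (T x) = x"
    and a: "\<And>n. clinear_on Y (a n)" "\<And>y. y \<in> Y \<Longrightarrow> (\<lambda>n. a n y *\<^sub>C e n) sums y"
    and K: "0 \<le> K" "\<And>m. cb_bounded_by Y (\<lambda>y. \<Sum>n<m. a n y *\<^sub>C e n) K"
  obtains V where "V \<subseteq> X\<^sub>0" "csubspace V" "closed V" "\<not> cfinite_dim V" "OAP V"
proof -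
  have X': "csubspace X\<^sub>0" "closed X\<^sub>0" "X\<^sub>0 \<subseteq> bounded_ops"
    using X(1) by (auto simp: operator_space_def)
  obtain J :: "('h \<Rightarrow>\<^sub>L 'h) \<Rightarrow> complex ell2" where J: "clinear_on X\<^sub>0 J" "bij_betw J X\<^sub>0 UNIV"
    "\<And>x. x \<in> X\<^sub>0 \<Longrightarrow> norm (J x) = norm x"
    using X(2) unfolding isometric_to_ell2_def by blast
  \<comment> \<open>The space of operators carries no inner product; orthogonality and expansions
    are handled in \<open>complex ell2\<close> and transported to \<open>X\<^sub>0\<close> by this
    isometry.\<close>
  define G where "G = inv_into X\<^sub>0 J"
  have GX: "G \<xi> \<in> X\<^sub>0" and JG: "J (G \<xi>) = \<xi>" for \<xi>
    using J(2) unfolding G_def bij_betw_def by (metis UNIV_I inv_into_into, metis UNIV_I f_inv_into_f)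
  have GJ: "G (J x) = x" if "x \<in> X\<^sub>0" for x
    using J(2) that unfolding G_def bij_betw_def by simp
  have Glin: "clinear_on UNIV G"
    unfolding clinear_on_def
  proof (intro conjI ballI allI)
    fix \<xi> \<eta> :: "complex ell2" and c
    show "G (\<xi> + \<eta>) = G \<xi> + G \<eta>"
      using GJ[of "G \<xi> + G \<eta>"] complex_vector.subspace_add[OF X'(1) GX GX]
      by (simp add: clinear_on_add[OF J(1)] GX JG)
    show "G (c *\<^sub>C \<xi>) = c *\<^sub>C G \<xi>"
      using GJ[of "c *\<^sub>C G \<xi>"] complex_vector.subspace_scale[OF X'(1) GX]
      by (simp add: clinear_on_scaleC[OF J(1)] GX JG)
  qed
  have Gnorm: "norm (G \<xi>) = norm \<xi>" for \<xi>
    using J(3)[OF GX] by (simp add: JG)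
  have Gbd: "bounded_clinear_on UNIV G"
    unfolding bounded_clinear_on_def using Glin Gnorm by (intro conjI exI[of _ 1]) simp_all
  have Ginj: "inj G" by (metis JG injI)
  have TG: "T (G \<xi>) \<in> Y" for \<xi> using T(4) GX by blast
  have TGlin: "clinear_on UNIV (\<lambda>\<xi>. T (G \<xi>))"
    using Glin T(1) GX by (simp add: clinear_on_def)
  \<comment> \<open>With the coefficients pulled back, \<open>R m\<close> is the partial sum
    operator after \<open>T\<close> and \<open>G\<close>, as the gliding hump requires.\<close>
  define b where "b = (\<lambda>n \<xi>. a n (T (G \<xi>)))"
  define R where "R = (\<lambda>m \<xi>. \<Sum>n<m. b n \<xi> *\<^sub>C e n)"
  have blin: "clinear_on UNIV (b n)" for n
    using TGlin a(1)[of n] TG by (simp add: clinear_on_def b_def)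
  have Rlin: "clinear_on UNIV (R m)" for m
    unfolding clinear_on_def R_def
    by (simp add: clinear_on_add[OF blin] clinear_on_scaleC[OF blin] scaleC_add_left sum.distrib
        complex_vector.scale_sum_right scaleC_scaleC scaleC_complex_def)
  \<comment> \<open>Continuity comes from the one-by-one case of the cb bounds; it is what allows
    \<open>R m\<close> to be evaluated along infinite expansions.\<close>
  have Rbd: "bounded_clinear_on UNIV (R m)" for m
  proof -
    have "norm (R m \<xi>) \<le> K * cT * norm \<xi>" for \<xi>
    proof -
      have "norm (R m \<xi>) \<le> K * norm (T (G \<xi>))"
        unfolding R_def b_def by (rule cb_bounded_by_norm[OF K(2) TG])
      also have "\<dots> \<le> K * (cT * norm \<xi>)"
        using cb_bounded_by_norm[OF T(3) GX[of \<xi>]] K(1) by (intro mult_left_mono) (simp_all add: Gnorm)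
      finally show ?thesis by (simp add: mult.assoc)
    qed
    then show ?thesis using Rlin unfolding bounded_clinear_on_def by blast
  qed
  have lim: "(\<lambda>m. R m \<xi>) \<longlonglongrightarrow> T (G \<xi>)" for \<xi>
    using a(2)[OF TG] unfolding R_def b_def sums_def .
  obtain x m where x: "orthonormal_on UNIV x" and Rx: "\<And>i k. i \<le> k \<Longrightarrow> R (m i) (x k) = 0"
    and err: "\<And>j k. j < k \<Longrightarrow> norm (T (G (x j)) - R (m k) (x j)) \<le> 1 / (real k + 1)"
    by (rule gliding_hump[of b e "\<lambda>\<xi>. T (G \<xi>)", OF blin lim[unfolded R_def] not_cfinite_dim_ell2])
      (rule that[unfolded R_def])
  define Q where "Q = (\<lambda>k \<xi>. \<Sum>j<k. cinner (x j) \<xi> *\<^sub>C x j)"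
  define W where "W = {\<xi>. (\<lambda>k. Q k \<xi>) \<longlonglongrightarrow> \<xi>}"
  have W: "csubspace W" "closed W" "\<And>j. x j \<in> W"
    unfolding W_def Q_def by (rule orthonormal_expansion_set[OF x])+
  have QW: "Q k \<xi> \<in> W" for k \<xi>
    unfolding Q_def by (intro complex_vector.subspace_sum[OF W(1)] complex_vector.subspace_scale[OF W(1)] W(3))
  define V where "V = G ` W"
  have VX: "V \<subseteq> X\<^sub>0" using GX by (auto simp: V_def)
  have Vsub: "csubspace V"
    unfolding V_def
  proof (rule complex_vector.subspaceI)
    show "0 \<in> G ` W"
      using complex_vector.subspace_0[OF W(1)] clinear_on_0[OF complex_vector.subspace_UNIV Glin]
      by (metis image_eqI)
    show "v + w \<in> G ` W" if "v \<in> G ` W" "w \<in> G ` W" for v w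
      using that by (auto simp: clinear_on_add[OF Glin, symmetric] intro!: imageI complex_vector.subspace_add[OF W(1)])
    show "c *\<^sub>C v \<in> G ` W" if "v \<in> G ` W" for c v
      using that by (auto simp: clinear_on_scaleC[OF Glin, symmetric] intro!: imageI complex_vector.subspace_scale[OF W(1)])
  qed
  have Vclosed: "closed V"
    unfolding closed_sequential_limits
  proof (intro allI impI, elim conjE)
    fix v l assume v: "\<forall>n. v n \<in> V" "v \<longlonglongrightarrow> l"
    have "v n \<in> X\<^sub>0" for n using v(1) VX by blast
    then have l: "l \<in> X\<^sub>0" by (rule closed_sequentially[OF X'(2) _ v(2)])
    have "bounded_clinear_on X\<^sub>0 J"
      unfolding bounded_clinear_on_def using J(1,3) by (intro conjI exI[of _ 1]) simp_all
    then have JV: "(\<lambda>n. J (v n)) \<longlonglongrightarrow> J l"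
      using \<open>\<And>n. v n \<in> X\<^sub>0\<close> l v(2) by (rule bounded_clinear_on_tendsto[OF X'(1)])
    have "J (v n) \<in> W" for n using v(1) JG unfolding V_def by (metis imageE)
    then have "J l \<in> W" by (rule closed_sequentially[OF W(2) _ JV])
    then show "l \<in> V" unfolding V_def using GJ[OF l] by (metis imageI)
  qed
  have Vinf: "\<not> cfinite_dim V"
    by (rule not_cfinite_dim_if_orthonormal_image[OF x Glin Ginj]) (auto simp: V_def W(3))
  define q where "q = (\<lambda>k v. G (Q k (J v)))"
  have qG: "q k (G \<xi>) = G (Q k \<xi>)" for k \<xi> by (simp add: q_def JG)
  have GQ: "G (Q k \<xi>) = (\<Sum>j<k. cinner (x j) \<xi> *\<^sub>C G (x j))" for k \<xi>
    unfolding Q_def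
    by (simp add: clinear_on_sum[OF complex_vector.subspace_UNIV Glin] clinear_on_scaleC[OF Glin])
  have \<phi>lin: "clinear_on X\<^sub>0 (\<lambda>v. cinner (x j) (J v))" for j
    unfolding clinear_on_def
    by (simp add: clinear_on_add[OF J(1)] clinear_on_scaleC[OF J(1)] cinner_add_right cinner_scaleC_right scaleC_complex_def)
  have \<phi>bd: "cmod (cinner (x j) (J v)) \<le> 1 * norm v" if "v \<in> X\<^sub>0" for j v
    using cmod_cinner_le_unit[of "x j" "J v"] x J(3)[OF that] by (simp add: orthonormal_on_def)
  have qlin: "clinear_on X\<^sub>0 (q k)" for k
    unfolding clinear_on_def q_def GQ
    by (simp add: clinear_on_add[OF \<phi>lin] clinear_on_scaleC[OF \<phi>lin] scaleC_add_left sum.distrib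
        complex_vector.scale_sum_right scaleC_scaleC scaleC_complex_def)
  define d where "d = (\<lambda>k j. T (G (x j)) - R (m k) (x j))"
  have Tq: "T (q k (G \<xi>)) = R (m k) \<xi> + (\<Sum>j<k. cinner (x j) \<xi> *\<^sub>C d k j)" if \<xi>: "\<xi> \<in> W" for k \<xi>
  proof -
    have RQ: "R (m k) (Q n \<xi>) = (\<Sum>j<n. cinner (x j) \<xi> *\<^sub>C R (m k) (x j))" for n
      unfolding Q_def
      by (simp add: clinear_on_sum[OF complex_vector.subspace_UNIV Rlin] clinear_on_scaleC[OF Rlin])
    \<comment> \<open>All terms of the expansion from index \<open>k\<close> on are killed by
      \<open>R (m k)\<close>, so the sequence is constant for \<open>n \<ge> k\<close> and its limit
      is the value on the finite sum \<open>Q k \<xi>\<close>.\<close>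
    have "(\<lambda>n. R (m k) (Q n \<xi>)) \<longlonglongrightarrow> R (m k) \<xi>"
      using \<xi> by (intro bounded_clinear_on_tendsto[OF complex_vector.subspace_UNIV Rbd]) (auto simp: W_def)
    moreover have "(\<lambda>n. R (m k) (Q n \<xi>)) \<longlonglongrightarrow> R (m k) (Q k \<xi>)"
    proof (intro tendsto_eventually eventually_sequentiallyI[of k])
      fix n assume "k \<le> n"
      then show "R (m k) (Q n \<xi>) = R (m k) (Q k \<xi>)"
        unfolding RQ using Rx by (intro sum.mono_neutral_right) auto
    qed
    ultimately have "R (m k) \<xi> = R (m k) (Q k \<xi>)" by (rule LIMSEQ_unique)
    moreover have "T (q k (G \<xi>)) = (\<Sum>j<k. cinner (x j) \<xi> *\<^sub>C T (G (x j)))"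
      unfolding qG Q_def
      by (simp add: clinear_on_sum[OF complex_vector.subspace_UNIV TGlin] clinear_on_scaleC[OF TGlin])
    ultimately show ?thesis
      by (simp add: RQ d_def complex_vector.scale_right_diff_distrib sum_subtractf)
  qed
  \<comment> \<open>\<open>K * cT\<close> bounds the partial sum operator after \<open>T\<close>,
    the summand 1 bounds the \<open>k\<close> rank-one corrections together, and \<open>cU\<close>
    is the cost of returning by \<open>U\<close>.\<close>
  define c where "c = cU * (K * cT + 1)"
  have c: "0 \<le> c" using U(1) K(1) T(2) by (simp add: c_def)
  have qcb: "cb_bounded_by V (q k) c" for k
    unfolding cb_bounded_by_def
  proof (intro allI impI)
    fix n and A :: "nat \<Rightarrow> nat \<Rightarrow> 'h \<Rightarrow>\<^sub>L 'h" assume A: "\<forall>i<n. \<forall>j<n. A i j \<in> V"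
    have AX: "A i j \<in> X\<^sub>0" if "i < n" "j < n" for i j using A VX that by blast
    have qX: "q k v \<in> X\<^sub>0" for v by (simp add: q_def GX)
    have "matrix_norm n (\<lambda>i j. T (q k (A i j)))
        = matrix_norm n (\<lambda>i j. (\<Sum>l<m k. a l (T (A i j)) *\<^sub>C e l) + (\<Sum>l<k. cinner (x l) (J (A i j)) *\<^sub>C d k l))"
    proof (rule matrix_norm_cong)
      fix i j assume "i < n" "j < n"
      then obtain \<xi> where "\<xi> \<in> W" "A i j = G \<xi>" using A by (auto simp: V_def)
      then show "T (q k (A i j)) = (\<Sum>l<m k. a l (T (A i j)) *\<^sub>C e l) + (\<Sum>l<k. cinner (x l) (J (A i j)) *\<^sub>C d k l)"
        using Tq[of \<xi> k] by (simp add: JG R_def b_def)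
    qed
    also have "\<dots> \<le> matrix_norm n (\<lambda>i j. \<Sum>l<m k. a l (T (A i j)) *\<^sub>C e l)
        + matrix_norm n (\<lambda>i j. \<Sum>l<k. cinner (x l) (J (A i j)) *\<^sub>C d k l)"
      by (rule matrix_norm_add_le)
    also have "\<dots> \<le> K * (cT * matrix_norm n A) + matrix_norm n A"
    proof (rule add_mono)
      have "matrix_norm n (\<lambda>i j. \<Sum>l<m k. a l (T (A i j)) *\<^sub>C e l) \<le> K * matrix_norm n (\<lambda>i j. T (A i j))"
        using AX T(4) by (intro cb_bounded_byD[OF K(2)]) blast
      also have "\<dots> \<le> K * (cT * matrix_norm n A)"
        using AX by (intro mult_left_mono K(1) cb_bounded_byD[OF T(3)])
      finally show "matrix_norm n (\<lambda>i j. \<Sum>l<m k. a l (T (A i j)) *\<^sub>C e l) \<le> K * (cT * matrix_norm n A)" .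
      have "matrix_norm n (\<lambda>i j. \<Sum>l<k. cinner (x l) (J (A i j)) *\<^sub>C d k l)
          \<le> (\<Sum>l<k. matrix_norm n (\<lambda>i j. cinner (x l) (J (A i j)) *\<^sub>C d k l))"
        by (rule matrix_norm_sum_le)
      also have "\<dots> \<le> (\<Sum>l<k. 1 / (real k + 1) * matrix_norm n A)"
      proof (rule sum_mono)
        fix l assume "l \<in> {..<k}"
        then have "norm (d k l) \<le> 1 / (real k + 1)" unfolding d_def using err by simp
        moreover have "matrix_norm n (\<lambda>i j. cinner (x l) (J (A i j)) *\<^sub>C d k l) \<le> 1 * norm (d k l) * matrix_norm n A"
          using AX by (intro cb_bounded_byD[OF rank_one_cb_bounded_by[OF X'(1,3) \<phi>lin \<phi>bd]]) simp_all
        ultimately show "matrix_norm n (\<lambda>i j. cinner (x l) (J (A i j)) *\<^sub>C d k l) \<le> 1 / (real k + 1) * matrix_norm n A"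
          using mult_right_mono[OF _ matrix_norm_nonneg, of "norm (d k l)" "1 / (real k + 1)" n A] by linarith
      qed
      also have "\<dots> = real k / (real k + 1) * matrix_norm n A" by simp
      also have "\<dots> \<le> 1 * matrix_norm n A"
        by (intro mult_right_mono matrix_norm_nonneg) simp
      finally show "matrix_norm n (\<lambda>i j. \<Sum>l<k. cinner (x l) (J (A i j)) *\<^sub>C d k l) \<le> matrix_norm n A"
        by simp
    qed
    finally have Tq_le: "matrix_norm n (\<lambda>i j. T (q k (A i j))) \<le> K * (cT * matrix_norm n A) + matrix_norm n A" .
    \<comment> \<open>Since \<open>q k\<close> takes values in \<open>X\<^sub>0\<close>, the entries
      \<open>T (q k (A i j))\<close> lie where the cb bound of \<open>U\<close> holds.\<close>
    have "matrix_norm n (\<lambda>i j. q k (A i j)) = matrix_norm n (\<lambda>i j. U (T (q k (A i j))))"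
      by (simp add: U(3) qX)
    also have "\<dots> \<le> cU * matrix_norm n (\<lambda>i j. T (q k (A i j)))"
      by (rule cb_bounded_byD[OF U(2)]) (simp add: qX)
    also have "\<dots> \<le> cU * (K * (cT * matrix_norm n A) + matrix_norm n A)"
      by (rule mult_left_mono[OF Tq_le U(1)])
    finally show "matrix_norm n (\<lambda>i j. q k (A i j)) \<le> c * matrix_norm n A"
      by (simp add: c_def algebra_simps)
  qed
  have "OAP V"
  proof (rule OAP_if_cb_approximation[of V q c])
    show "operator_space V"
      using Vsub Vclosed VX X'(3) by (auto simp: operator_space_def)
    show "q k ` V \<subseteq> V" for k
      unfolding V_def by (auto simp: qG QW)
    show "clinear_on V (q k)" for k
      by (rule clinear_on_subset[OF qlin VX])
    show "cfinite_dim (q k ` V)" for k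
      unfolding cfinite_dim_def
    proof (intro exI[of _ "(\<lambda>j. G (x j)) ` {..<k}"] conjI subsetI)
      fix v assume "v \<in> q k ` V"
      then obtain \<xi> where "v = G (Q k \<xi>)" by (auto simp: q_def)
      then show "v \<in> cspan ((\<lambda>j. G (x j)) ` {..<k})"
        unfolding GQ
        by (simp, intro complex_vector.span_sum complex_vector.span_scale)
          (auto intro: complex_vector.span_base)
    qed simp
    show "cb_bounded_by V (q k) c" for k by (rule qcb)
    show "0 \<le> c" by (rule c)
    show "(\<lambda>k. q k v) \<longlonglongrightarrow> v" if "v \<in> V" for v
    proof -
      obtain \<xi> where \<xi>: "\<xi> \<in> W" "v = G \<xi>" using \<open>v \<in> V\<close> by (auto simp: V_def)
      then show ?thesis
        unfolding \<xi>(2) qG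
        by (intro bounded_clinear_on_tendsto[OF complex_vector.subspace_UNIV Gbd]) (auto simp: W_def)
    qed
  qed
  then show ?thesis using that[OF VX Vsub Vclosed Vinf] by blast
qed

section \<open>Reduction of bases and frames to linear expansions\<close>

text \<open>Sums and multiples of expansions are again expansions, and by uniqueness they are the
  chosen ones; hence the coefficients are linear.\<close>

lemma schauder_basis_coefficients:
  assumes Y: "csubspace Y" and e: "schauder_basis Y e"
  defines "a \<equiv> \<lambda>n y. (THE \<alpha>. (\<lambda>n. \<alpha> n *\<^sub>C e n) sums y) n"
  shows "\<And>y. y \<in> Y \<Longrightarrow> (\<lambda>n. a n y *\<^sub>C e n) sums y" "clinear_on Y (a n)"
proof -
  have uniq: "\<exists>!\<alpha>. (\<lambda>n. \<alpha> n *\<^sub>C e n) sums y" if "y \<in> Y" for y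
    using e that unfolding schauder_basis_def by blast
  show sums: "(\<lambda>n. a n y *\<^sub>C e n) sums y" if "y \<in> Y" for y
    unfolding a_def by (rule theI'[OF uniq[OF that]])
  have eq: "(\<lambda>n. a n y) = \<alpha>" if "y \<in> Y" "(\<lambda>n. \<alpha> n *\<^sub>C e n) sums y" for y \<alpha>
    unfolding a_def by (rule the1_equality[OF uniq[OF that(1)]]) (rule that(2))
  show "clinear_on Y (a n)"
    unfolding clinear_on_def
  proof (intro conjI ballI allI)
    fix y z c assume y: "y \<in> Y" and z: "z \<in> Y"
    have "(\<lambda>n. (a n y + a n z) *\<^sub>C e n) sums (y + z)"
      using sums_add[OF sums[OF y] sums[OF z]] by (simp add: scaleC_add_left)
    from fun_cong[OF eq[OF complex_vector.subspace_add[OF Y y z] this]]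
    show "a n (y + z) = a n y + a n z" .
    have "(\<lambda>n. (c * a n y) *\<^sub>C e n) sums (c *\<^sub>C y)"
      using bounded_linear.sums[OF bounded_linear_scaleC_right sums[OF y]] by (simp add: scaleC_scaleC)
    from fun_cong[OF eq[OF complex_vector.subspace_scale[OF Y y] this]]
    show "a n (c *\<^sub>C y) = c *\<^sub>C a n y" by (simp add: scaleC_complex_def)
  qed
qed

text \<open>The hypotheses on \<open>a\<close> and \<open>e\<close> are what cb-bases and cb-frames
  have in common: linear coefficients, convergent expansions and uniformly completely bounded
  partial sums.\<close>

lemma not_completely_isomorphic_into_cb_expansion:
  fixes X\<^sub>0 :: "('h::chilbert_space \<Rightarrow>\<^sub>L 'h) set" and Y :: "('k::chilbert_space \<Rightarrow>\<^sub>L 'k) set"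
  assumes X: "operator_space X\<^sub>0" "isometric_to_ell2 X\<^sub>0"
    and no_OAP: "\<And>V. V \<subseteq> X\<^sub>0 \<Longrightarrow> csubspace V \<Longrightarrow> closed V \<Longrightarrow> \<not> cfinite_dim V \<Longrightarrow> \<not> OAP V"
    and Y: "csubspace Y" and Z: "Z \<subseteq> Y" "csubspace Z"
    and a: "\<And>n. clinear_on Y (a n)" "\<And>y. y \<in> Y \<Longrightarrow> (\<lambda>n. a n y *\<^sub>C e n) sums y"
    and sup: "(SUP m. cb_norm Y (\<lambda>y. \<Sum>n<m. a n y *\<^sub>C e n)) < \<infinity>"
  shows "\<not> completely_isomorphic X\<^sub>0 Z"
proof
  assume "completely_isomorphic X\<^sub>0 Z"
  then obtain T where T: "bij_betw T X\<^sub>0 Z" "completely_bounded X\<^sub>0 T" "completely_bounded Z (inv_into X\<^sub>0 T)"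
    unfolding completely_isomorphic_def by blast
  have X': "csubspace X\<^sub>0" using X(1) by (simp add: operator_space_def)
  have TX: "T ` X\<^sub>0 = Z" "inj_on T X\<^sub>0" using T(1) by (auto simp: bij_betw_def)
  obtain cT where cT: "0 \<le> cT" "cb_bounded_by X\<^sub>0 T cT"
    using cb_norm_finite_imp_cb_bounded_by[OF X'] T(2) unfolding completely_bounded_def by blast
  obtain cU where cU: "0 \<le> cU" "cb_bounded_by Z (inv_into X\<^sub>0 T) cU"
    using cb_norm_finite_imp_cb_bounded_by[OF Z(2)] T(3) unfolding completely_bounded_def by blast
  define K where "K = enn2real (SUP m. cb_norm Y (\<lambda>y. \<Sum>n<m. a n y *\<^sub>C e n))"
  have K: "cb_bounded_by Y (\<lambda>y. \<Sum>n<m. a n y *\<^sub>C e n) K" for m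
  proof (rule cb_norm_le_imp_cb_bounded_by[OF Y])
    show "clinear_on Y (\<lambda>y. \<Sum>n<m. a n y *\<^sub>C e n)"
      unfolding clinear_on_def
      by (simp add: clinear_on_add[OF a(1)] clinear_on_scaleC[OF a(1)] scaleC_add_left sum.distrib
          complex_vector.scale_sum_right scaleC_scaleC scaleC_complex_def)
    have "cb_norm Y (\<lambda>y. \<Sum>n<m. a n y *\<^sub>C e n) \<le> (SUP m. cb_norm Y (\<lambda>y. \<Sum>n<m. a n y *\<^sub>C e n))"
      by (rule SUP_upper) simp
    also have "\<dots> = ennreal K" unfolding K_def using sup by simp
    finally show "cb_norm Y (\<lambda>y. \<Sum>n<m. a n y *\<^sub>C e n) \<le> ennreal K" .
  qed (simp add: K_def)
  obtain V where "V \<subseteq> X\<^sub>0" "csubspace V" "closed V" "\<not> cfinite_dim V" "OAP V"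
  proof (rule OAP_subspace_of_hilbertian[OF X _ cT _ cU(1) _ _ a _ K])
    show "clinear_on X\<^sub>0 T" using T(2) by (simp add: completely_bounded_def)
    show "T ` X\<^sub>0 \<subseteq> Y" using TX Z by simp
    show "cb_bounded_by (T ` X\<^sub>0) (inv_into X\<^sub>0 T) cU" using cU(2) TX by simp
    show "inv_into X\<^sub>0 T (T x) = x" if "x \<in> X\<^sub>0" for x using TX(2) that by simp
    show "0 \<le> K" by (simp add: K_def)
  qed
  then show False using no_OAP by blast
qed

theorem theorem4p5:
  fixes X\<^sub>0 :: "('h::chilbert_space \<Rightarrow>\<^sub>L 'h) set"
    and Y :: "('k::chilbert_space \<Rightarrow>\<^sub>L 'k) set"
  assumes "operator_space X\<^sub>0"
    and "separable_space (top_of_set X\<^sub>0)"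
    and "isometric_to_ell2 X\<^sub>0"
    and "\<And>V. V \<subseteq> X\<^sub>0 \<Longrightarrow> csubspace V \<Longrightarrow> closed V \<Longrightarrow> \<not> cfinite_dim V \<Longrightarrow> \<not> OAP V"
    and "operator_space Y"
  shows "((\<exists>e. cb_basis Y e) \<longrightarrow> \<not> (\<exists>Z\<subseteq>Y. csubspace Z \<and> completely_isomorphic X\<^sub>0 Z)) \<and>
    ((\<exists>x f. cb_frame Y x f) \<longrightarrow> \<not> (\<exists>Z\<subseteq>Y. csubspace Z \<and> completely_isomorphic X\<^sub>0 Z))"
proof -
  have Y: "csubspace Y" using assms(5) by (simp add: operator_space_def)
  note key = not_completely_isomorphic_into_cb_expansion[OF assms(1,3,4) Y]
  have "\<not> completely_isomorphic X\<^sub>0 Z" if e: "cb_basis Y e" and Z: "Z \<subseteq> Y" "csubspace Z" for e Z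
  \<comment> \<open>The coefficients are written with the same \<open>THE\<close> term as in
    \<open>basis_proj\<close>, so that the partial sums are literally the natural
    projections.\<close>
  proof (rule key[OF _ _ _ _ Z])
    have e': "schauder_basis Y e" using e by (simp add: cb_basis_def)
    show "clinear_on Y (\<lambda>y. (THE \<alpha>. (\<lambda>n. \<alpha> n *\<^sub>C e n) sums y) n)" for n
      by (rule schauder_basis_coefficients(2)[OF Y e'])
    show "(\<lambda>n. (THE \<alpha>. (\<lambda>n. \<alpha> n *\<^sub>C e n) sums y) n *\<^sub>C e n) sums y" if "y \<in> Y" for y
      by (rule schauder_basis_coefficients(1)[OF Y e' that])
    show "(SUP m. cb_norm Y (\<lambda>y. \<Sum>n<m. (THE \<alpha>. (\<lambda>n. \<alpha> n *\<^sub>C e n) sums y) n *\<^sub>C e n)) < \<infinity>"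
      using e unfolding cb_basis_def basis_proj_def[abs_def] by blast
  qed
  moreover have "\<not> completely_isomorphic X\<^sub>0 Z" if f: "cb_frame Y x f" and Z: "Z \<subseteq> Y" "csubspace Z" for x f Z
    using f by (intro key[OF _ _ _ _ Z, of f x]) (auto simp: cb_frame_def bounded_clinear_on_def)
  ultimately show ?thesis by blast
qed

end
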